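(* Let $\mathcal{H}_1,\mathcal{H}_2$ be real Hilbert spaces and let $C\subset\mathcal{H}_1$, $Q\subset\mathcal{H}_2$ be nonempty closed convex subsets. Let $S:C\to C$ and $T:Q\to Q$ be nonexpansive mappings, let $g:Q\times Q\to\mathbb{R}$ satisfy Assumptions A, and let $f:C\times C\to\mathbb{R}$ satisfy Assumptions B (with Lipschitz-type constants $c_1,c_2>0$). Let $A:\mathcal{H}_1\to\mathcal{H}_2$ be a bounded linear operator with adjoint $A^*$. Let $\{\lambda_k\}\subset[a,b]$ for some $a,b\in\left(0,\min\left\{\frac{1}{2c_1},\frac{1}{2c_2}\right\}\right)$; $0<\alpha<1$; $0<\mu<\frac{1}{\|A\|^2}$; $\{\alpha_k\}\subset(0,+\infty)$ with $\liminf_{k\to+\infty}\alpha_k>0$. Let $x^1\in C_1=C$ and consider the sequences $\{x^k\},\{y^k\},\{z^k\},\{t^k\},\{u^k\}$ generated for $k=1,2,\dots$ by $$\begin{cases} y^k=\arg\min\left\{\lambda_k f(x^k,y)+\frac12\|y-x^k\|^2: y\in C\right\},\\ z^k=\arg\min\left\{\lambda_k f(y^k,y)+\frac12\|y-x^k\|^2: y\in C\right\},\\ t^k=(1-\alpha)z^k+\alpha S z^k,\\ u^k=T_{\alpha_k}^g A t^k,\\ s^k=P_C\left(t^k+\mu A^*(Tu^k-At^k)\right),\\ C_{k+1}=\{r\in C_k: \|s^k-r\|\le\|t^k-r\|\le\|x^k-r\|\},\\ x^{k+1}=P_{C_{k+1}}(x^1).\end{cases}$$ If $\Omega=\{x^*\in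 \mathrm{Sol}(C,f)\cap \mathrm{Fix}(S): Ax^*\in \mathrm{Sol}(Q,g)\cap \mathrm{Fix}(T)\}\neq\emptyset$, then the sequences $\{x^k\}$ and $\{z^k\}$ converge strongly to an element $p\in\Omega$ and $\{u^k\}$ converges strongly to $Ap\in \mathrm{Sol}(Q,g)\cap \mathrm{Fix}(T)$.
   Context: A mapping $S:C\to C$ is nonexpansive if $\|Sx-Sy\|\le\|x-y\|$ for all $x,y\in C$. $\mathrm{Fix}(S)=\{x\in C: Sx=x\}$ and $\mathrm{Fix}(T)=\{u\in Q: Tu=u\}$. $\mathrm{Sol}(C,f)=\{\bar x\in C: f(\bar x,y)\ge 0\ \forall y\in C\}$ and $\mathrm{Sol}(Q,g)=\{\bar u\in Q: g(\bar u,v)\ge 0\ \forall v\in Q\}$. For a nonempty closed convex set $D$, $P_D$ is the metric projection onto $D$: $P_D(x)\in D$ and $\|x-P_D(x)\|\le\|x-y\|$ for all $y\in D$. Strong convergence means convergence in norm. Assumptions A on $g:Q\times Q\to\mathbb{R}$: (A1) $g(u,u)=0$ for all $u\in Q$; (A2) $g$ is monotone on $Q$: $g(u,v)+g(v,u)\le 0$ for all $u,v\in Q$; (A3) for each $u,v,w\in Q$, $\limsup_{\lambda\downarrow 0} g(\lambda w+(1-\lambda)u,v)\le g(u,v)$; (A4) $g(u,\cdot)$ is convex and lower semicontinuous on $Q$ for each $u\in Q$. Assumptions B on $f:C\times C\to\mathbb{R}$: (B1) $f(x,x)=0$ for all $x\in C$; (B2) $f$ is pseudomonotone on $C$: $f(x,y)\ge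 0$ implies $f(y,x)\le 0$, for all $x,y\in C$; (B3) $f$ is jointly weakly continuous on $C\times C$: if $x,y\in C$ and sequences $\{x^k\},\{y^k\}\subset C$ converge weakly to $x$ and $y$ respectively, then $f(x^k,y^k)\to f(x,y)$; (B4) $f(x,\cdot)$ is convex and subdifferentiable on $C$ for all $x\in C$; (B5) $f$ is Lipschitz-type continuous on $C$ with constants $c_1>0$, $c_2>0$: $f(x,y)+f(y,z)\ge f(x,z)-c_1\|x-y\|^2-c_2\|y-z\|^2$ for all $x,y,z\in C$. For $\alpha>0$ and $u\in\mathcal{H}_2$, $T_\alpha^g(u)$ denotes the (unique, under Assumptions A) point $w\in Q$ such that $g(w,v)+\frac1\alpha\langle v-w,w-u\rangle\ge 0$ for all $v\in Q$. *)

theory Defs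
  imports "HOL-Analysis.Analysis"
begin

text \<open>
  A real Hilbert space is a type of sort \<open>{real_inner, banach}\<close>. Mappings and bifunctions on a
  subset \<open>D\<close> are total functions of which only the values on \<open>D\<close> are constrained or used.
\<close>

definition nonexpansive_on :: "'a::real_normed_vector set \<Rightarrow> ('a \<Rightarrow> 'a) \<Rightarrow> bool" where
  "nonexpansive_on D S \<longleftrightarrow> S \<in> D \<rightarrow> D \<and> (\<forall>x\<in>D. \<forall>y\<in>D. norm (S x - S y) \<le> norm (x - y))"

definition fix_set :: "'a set \<Rightarrow> ('a \<Rightarrow> 'a) \<Rightarrow> 'a set" where
  "fix_set D S = {x \<in> D. S x = x}"

definition sol_set :: "'a set \<Rightarrow> ('a \<Rightarrow> 'a \<Rightarrow> real) \<Rightarrow> 'a set" where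
  "sol_set D f = {x \<in> D. \<forall>y\<in>D. f x y \<ge> 0}"

definition weakly_converges :: "(nat \<Rightarrow> 'a::real_normed_vector) \<Rightarrow> 'a \<Rightarrow> bool" where
  "weakly_converges X x \<longleftrightarrow>
     (\<forall>\<phi>::'a \<Rightarrow> real. bounded_linear \<phi> \<longrightarrow> (\<lambda>k. \<phi> (X k)) \<longlonglongrightarrow> \<phi> x)"

text \<open>
  The filter \<open>at x within D\<close> omits \<open>x\<close> itself, which is harmless for lower semicontinuity; at an
  isolated point of \<open>D\<close> it is trivial and \<open>Liminf\<close> is \<open>\<infinity>\<close>, so the condition holds.
\<close>

definition lsc_on :: "'a::topological_space set \<Rightarrow> ('a \<Rightarrow> real) \<Rightarrow> bool" where
  "lsc_on D h \<longleftrightarrow> (\<forall>x\<in>D. ereal (h x) \<le> Liminf (at x within D) (\<lambda>y. ereal (h y)))"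

definition subdifferential_on :: "'a::real_inner set \<Rightarrow> ('a \<Rightarrow> real) \<Rightarrow> 'a \<Rightarrow> 'a set" where
  "subdifferential_on D h x = {w. \<forall>y\<in>D. h y \<ge> h x + w \<bullet> (y - x)}"

definition subdifferentiable_on :: "'a::real_inner set \<Rightarrow> ('a \<Rightarrow> real) \<Rightarrow> bool" where
  "subdifferentiable_on D h \<longleftrightarrow> (\<forall>x\<in>D. subdifferential_on D h x \<noteq> {})"

definition assumptions_A :: "'a::real_inner set \<Rightarrow> ('a \<Rightarrow> 'a \<Rightarrow> real) \<Rightarrow> bool" where
  "assumptions_A Q g \<longleftrightarrow>
     (\<forall>u\<in>Q. g u u = 0) \<and>
     (\<forall>u\<in>Q. \<forall>v\<in>Q. g u v + g v u \<le> 0) \<and>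
     (\<forall>u\<in>Q. \<forall>v\<in>Q. \<forall>w\<in>Q.
        Limsup (at_right 0) (\<lambda>l::real. ereal (g (l *\<^sub>R w + (1 - l) *\<^sub>R u) v)) \<le> ereal (g u v)) \<and>
     (\<forall>u\<in>Q. convex_on Q (g u) \<and> lsc_on Q (g u))"

definition assumptions_B ::
    "'a::real_inner set \<Rightarrow> ('a \<Rightarrow> 'a \<Rightarrow> real) \<Rightarrow> real \<Rightarrow> real \<Rightarrow> bool" where
  "assumptions_B C f c1 c2 \<longleftrightarrow>
     (\<forall>x\<in>C. f x x = 0) \<and>
     (\<forall>x\<in>C. \<forall>y\<in>C. f x y \<ge> 0 \<longrightarrow> f y x \<le> 0) \<and>
     (\<forall>X Y. \<forall>x\<in>C. \<forall>y\<in>C.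
        (\<forall>k. X k \<in> C) \<and> (\<forall>k. Y k \<in> C) \<and> weakly_converges X x \<and> weakly_converges Y y
          \<longrightarrow> (\<lambda>k. f (X k) (Y k)) \<longlonglongrightarrow> f x y) \<and>
     (\<forall>x\<in>C. convex_on C (f x) \<and> subdifferentiable_on C (f x)) \<and>
     c1 > 0 \<and> c2 > 0 \<and>
     (\<forall>x\<in>C. \<forall>y\<in>C. \<forall>z\<in>C.
        f x y + f y z \<ge> f x z - c1 * (norm (x - y))\<^sup>2 - c2 * (norm (y - z))\<^sup>2)"

text \<open>
  The library's \<^const>\<open>closest_point\<close> requires the sort \<open>heine_borel\<close> and hence does not apply to
  infinite-dimensional Hilbert spaces.
\<close>

definition metric_proj :: "'a::real_normed_vector set \<Rightarrow> 'a \<Rightarrow> 'a" where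
  "metric_proj D x = (THE p. p \<in> D \<and> (\<forall>y\<in>D. norm (x - p) \<le> norm (x - y)))"

definition resolvent ::
    "'a::real_inner set \<Rightarrow> ('a \<Rightarrow> 'a \<Rightarrow> real) \<Rightarrow> real \<Rightarrow> 'a \<Rightarrow> 'a" where
  "resolvent Q g \<alpha> u = (THE w. w \<in> Q \<and> (\<forall>v\<in>Q. g w v + 1 / \<alpha> * ((v - w) \<bullet> (w - u)) \<ge> 0))"

end

theory Submission
  imports Defs
begin

text \<open>
  The proof follows the squared distance to a point \<open>q\<close> of \<open>\<Omega>\<close> through one step of the iteration. The
  extragradient step, the relaxation with \<open>S\<close> and the step through the second space each do not
  increase it, and what is lost is quantified: the loss from \<open>x k\<close> to \<open>z k\<close> dominates
  multiples of \<open>\<parallel>x k - y k\<parallel>\<^sup>2\<close> and \<open>\<parallel>y k - z k\<parallel>\<^sup>2\<close> (\<open>extragradient_dist_sq_le\<close>), and the loss from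
  \<open>t k\<close> to \<open>s k\<close> dominates multiples of \<open>\<parallel>u k - A (t k)\<parallel>\<^sup>2\<close> and \<open>\<parallel>T (u k) - A (t k)\<parallel>\<^sup>2\<close>
  (\<open>split_step_dist_sq_le\<close>). Consequently \<open>\<Omega>\<close> lies in every set \<open>Cs k\<close>.

  Each \<open>Cs k\<close> is closed and convex, being cut out of \<open>C\<close> by half-spaces. The projections of one point
  onto a decreasing sequence of closed convex sets with a common point always converge in norm
  (\<open>metric_proj_decreasing_convergent\<close>): their distances to the projected point increase and stay
  bounded, and the increments control the mutual distances. Hence \<open>x\<close> converges to some \<open>p\<close>, and since
  \<open>x (k + 1)\<close> lies in \<open>Cs (k + 1)\<close>, the sequences \<open>t\<close> and \<open>s\<close> converge to \<open>p\<close> as well. For a fixed \<open>q\<close>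
  all the distances now have the same limit, so the losses tend to \<open>0\<close>: \<open>y\<close> and \<open>z\<close> tend to \<open>p\<close>,
  and \<open>u\<close> and \<open>T u\<close> tend to \<open>A p\<close>. As all this is convergence in norm, that \<open>p\<close> belongs to \<open>\<Omega>\<close>
  is obtained by passing to the limit in the inequalities that characterise \<open>y k\<close> and \<open>u k\<close>
  (\<open>prox_limit_in_sol_set\<close>, \<open>resolvent_limit_in_sol_set\<close>).

  The objects of the iteration must also be shown to exist. Minimisers of a convex lower semicontinuous
  function plus a squared distance exist because the parallelogram law makes every minimising sequence
  Cauchy (\<open>prox_exists\<close>); this covers the two proximal points and metric projections, and through
  projections the Riesz representation behind the adjoint. The resolvent is harder
  (\<open>resolvent_exists\<close>). By Minty's trick it suffices to solve the dual inequalities, which ask for a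
  point in an intersection of bounded closed convex sets, one for each \<open>v \<in> Q\<close> and \<open>e > 0\<close>.
  Such a family with the finite intersection property has a common point
  (\<open>closed_convex_bounded_fip\<close>), and finitely many of the inequalities can be solved approximately by a
  theorem of the alternative for convex functions: otherwise a convex combination of them would be
  violated everywhere, in particular at the corresponding combination of the points \<open>v\<close>, where
  monotonicity forbids it (\<open>approximate_dual_solution_finite\<close>).
\<close>

section \<open>Semicontinuity, convexity and minimisation in a Hilbert space\<close>

text \<open>
  Passing from the punctured filter to \<open>nhds x\<close> costs nothing, since \<open>c < h x\<close> covers the point \<open>x\<close>.
\<close>
lemma lsc_on_eventually_gt:
  assumes "lsc_on D h" "x \<in> D" "c < h x"
  shows "\<forall>\<^sub>F y in nhds x. y \<in> D \<longrightarrow> c < h y"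
proof -
  have "ereal (h x) \<le> Liminf (at x within D) (\<lambda>y. ereal (h y))"
    using assms(1,2) unfolding lsc_on_def by blast
  then have "\<forall>\<^sub>F y in at x within D. ereal c < ereal (h y)"
    using assms(3) unfolding le_Liminf_iff by (metis less_ereal.simps(1))
  then show ?thesis
    unfolding eventually_at_filter using assms(3) by (auto elim!: eventually_mono)
qed

lemma lsc_on_tendsto_le:
  fixes X :: "nat \<Rightarrow> 'a::topological_space"
  assumes "lsc_on D h" "x \<in> D" "X \<longlonglongrightarrow> x" "\<And>n. X n \<in> D"
    and "r \<longlonglongrightarrow> r0" "\<And>n. h (X n) \<le> r n"
  shows "h x \<le> r0"
proof (rule ccontr)
  assume "\<not> h x \<le> r0"
  then obtain c where c: "r0 < c" "c < h x"
    using dense not_le by metis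
  have "\<forall>\<^sub>F n in sequentially. c < h (X n)"
    using lsc_on_eventually_gt[OF assms(1,2) c(2)] assms(3,4)
    by (auto simp: filterlim_iff elim!: eventually_mono)
  moreover have "\<forall>\<^sub>F n in sequentially. r n < c"
    using assms(5) c(1) by (rule order_tendstoD(2))
  ultimately have "\<forall>\<^sub>F n in sequentially. False"
    by eventually_elim (use assms(6) in \<open>smt (verit)\<close>)
  then show False by simp
qed

lemma closed_sublevel_lsc_on_add_continuous:
  fixes h k :: "'a::metric_space \<Rightarrow> real"
  assumes "lsc_on D h" "continuous_on UNIV k" "closed D"
  shows "closed {x \<in> D. h x + k x \<le> c}"
  unfolding closed_sequential_limits
proof (intro allI impI, elim conjE)
  fix X x
  assume X: "\<forall>n. X n \<in> {x \<in> D. h x + k x \<le> c}" "X \<longlonglongrightarrow> x"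
  have xD: "x \<in> D" by (rule closed_sequentially[OF assms(3) _ X(2)]) (use X(1) in blast)
  have lim: "(\<lambda>n. c - k (X n)) \<longlonglongrightarrow> c - k x"
    using assms(2) X(2) by (intro tendsto_intros) (auto intro: continuous_on_tendsto_compose)
  have "h x \<le> c - k x"
    by (rule lsc_on_tendsto_le[OF assms(1) xD X(2) _ lim]) (use X(1) in \<open>auto simp: algebra_simps\<close>)
  then show "x \<in> {x \<in> D. h x + k x \<le> c}" using xD by auto
qed

lemma subdifferentiable_on_imp_lsc_on:
  fixes D :: "'a::real_inner set"
  assumes "subdifferentiable_on D h"
  shows "lsc_on D h"
  unfolding lsc_on_def le_Liminf_iff
proof (intro ballI allI impI)
  fix x c assume x: "x \<in> D" and c: "c < ereal (h x)"
  obtain w where w: "\<forall>y\<in>D. h y \<ge> h x + w \<bullet> (y - x)"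
    using assms x unfolding subdifferentiable_on_def subdifferential_on_def by blast
  have "((\<lambda>y. ereal (h x + w \<bullet> (y - x))) \<longlongrightarrow> ereal (h x + w \<bullet> (x - x))) (at x within D)"
    by (intro tendsto_intros)
  then have "\<forall>\<^sub>F y in at x within D. c < ereal (h x + w \<bullet> (y - x))"
    by (rule order_tendstoD) (use c in simp)
  moreover have "\<forall>\<^sub>F y in at x within D. y \<in> D"
    by (auto simp: eventually_at_filter)
  ultimately show "\<forall>\<^sub>F y in at x within D. c < ereal (h y)"
    by eventually_elim (use w in \<open>auto intro: less_le_trans\<close>)
qed

text \<open>
  Lower semicontinuity bounds \<open>h\<close> from below near \<open>v\<close>, and convexity along the segment from \<open>v\<close> to a
  distant \<open>w\<close> turns this into a bound that decreases at most linearly. It replaces an affine minorant,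
  which would need a separation theorem in the Hilbert space.
\<close>
lemma convex_on_lsc_lower_bound:
  fixes D :: "'a::real_normed_vector set"
  assumes conv: "convex_on D h" and lsc: "lsc_on D h" and v: "v \<in> D"
  obtains K where "K \<ge> 0" "\<And>w. w \<in> D \<Longrightarrow> h v - 1 - K * norm (w - v) \<le> h w"
proof -
  obtain d where d: "d > 0" "\<And>w. w \<in> D \<Longrightarrow> dist w v < d \<Longrightarrow> h v - 1 < h w"
    using lsc_on_eventually_gt[OF lsc v, of "h v - 1"] by (auto simp: eventually_nhds_metric)
  have "h v - 1 - 2 / d * norm (w - v) \<le> h w" if w: "w \<in> D" for w
  proof (cases "norm (w - v) < d")
    case True
    have "0 \<le> 2 / d * norm (w - v)" using d(1) by simp
    then show ?thesis using d(2)[OF w] True by (auto simp: dist_norm)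
  next
    case False
    define l where "l = d / (2 * norm (w - v))"
    have n: "norm (w - v) \<ge> d" "norm (w - v) > 0" using False d(1) by auto
    have l: "0 < l" "l \<le> 1" using n d(1) by (auto simp: l_def field_simps)
    define p where "p = (1 - l) *\<^sub>R v + l *\<^sub>R w"
    have p: "p \<in> D"
      unfolding p_def using convex_on_imp_convex[OF conv] v w l by (auto intro: convexD_alt)
    have "p - v = l *\<^sub>R (w - v)" by (simp add: p_def algebra_simps)
    then have "norm (p - v) = d / 2" using l n d(1) by (simp add: l_def)
    then have "h v - 1 < h p" using d p by (auto simp: dist_norm)
    also have "\<dots> \<le> (1 - l) * h v + l * h w"
      unfolding p_def using convex_onD[OF conv] l v w by simp
    finally have "- 1 < l * (h w - h v)" by (simp add: algebra_simps)
    then have "- (1 / l) \<le> h w - h v" using l(1) by (simp add: field_simps)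
    moreover have "1 / l = 2 / d * norm (w - v)" using n d(1) by (simp add: l_def field_simps)
    ultimately show ?thesis by simp
  qed
  then show thesis using that[of "2 / d"] d(1) by simp
qed

lemma norm_midpoint_sq:
  fixes x a b :: "'a::real_inner"
  shows "(norm ((1/2) *\<^sub>R a + (1/2) *\<^sub>R b - x))\<^sup>2
    = ((norm (a - x))\<^sup>2 + (norm (b - x))\<^sup>2) / 2 - (norm (a - b))\<^sup>2 / 4"
  by (simp add: power2_norm_eq_inner inner_commute algebra_simps) (simp add: field_simps)

text \<open>
  By the parallelogram law, two almost minimal points are close to each other, so a minimising sequence
  is Cauchy; the linear lower bound on \<open>\<phi>\<close> is dominated by the square, hence the infimum is finite.
\<close>
lemma prox_exists:
  fixes C :: "'a::{real_inner, banach} set"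
  assumes "C \<noteq> {}" "closed C" and conv: "convex_on C \<phi>" and lsc: "lsc_on C \<phi>"
  obtains z where "z \<in> C"
    "\<And>v. v \<in> C \<Longrightarrow> \<phi> z + 1 / 2 * (norm (z - x))\<^sup>2 \<le> \<phi> v + 1 / 2 * (norm (v - x))\<^sup>2"
proof -
  define J where "J v = \<phi> v + 1 / 2 * (norm (v - x))\<^sup>2" for v
  define m where "m = Inf (J ` C)"
  obtain v0 where v0: "v0 \<in> C" using assms(1) by blast
  obtain K where K: "K \<ge> 0" "\<And>w. w \<in> C \<Longrightarrow> \<phi> v0 - 1 - K * norm (w - v0) \<le> \<phi> w"
    using convex_on_lsc_lower_bound[OF conv lsc v0] by blast
  have low: "\<phi> v0 - 1 - K * norm (x - v0) - K\<^sup>2 / 2 \<le> J w" if w: "w \<in> C" for w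
  proof -
    have "norm (w - v0) \<le> norm (w - x) + norm (x - v0)"
      using norm_triangle_ineq[of "w - x" "x - v0"] by simp
    then have "K * norm (w - v0) \<le> K * norm (w - x) + K * norm (x - v0)"
      using K(1) by (metis distrib_left mult_left_mono)
    moreover have "0 \<le> (norm (w - x) - K)\<^sup>2" by simp
    then have "K * norm (w - x) \<le> 1 / 2 * (norm (w - x))\<^sup>2 + K\<^sup>2 / 2"
      by (simp add: power2_diff field_simps)
    ultimately show ?thesis using K(2)[OF w] unfolding J_def by linarith
  qed
  then have bdd: "bdd_below (J ` C)" by (auto simp: bdd_below_def)
  have m: "m \<le> J w" if "w \<in> C" for w
    unfolding m_def using bdd that by (simp add: cInf_lower)
  have "\<exists>w\<in>C. J w < m + 1 / real (Suc n)" for n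
  proof -
    have "Inf (J ` C) < m + 1 / real (Suc n)" by (simp add: m_def)
    then show ?thesis using cInf_lessD[of "J ` C"] assms(1) by auto
  qed
  then obtain X where X: "\<And>n. X n \<in> C" "\<And>n. J (X n) < m + 1 / real (Suc n)" by metis
  have lim: "(\<lambda>n. 1 / real (Suc n)) \<longlonglongrightarrow> 0"
    by (rule LIMSEQ_Suc[OF lim_1_over_n])
  have mid: "(norm (p - q))\<^sup>2 \<le> 4 * (J p - m) + 4 * (J q - m)" if pq: "p \<in> C" "q \<in> C" for p q
  proof -
    define c where "c = (1 - 1/2) *\<^sub>R p + (1/2::real) *\<^sub>R q"
    have "c \<in> C"
      unfolding c_def using convex_on_imp_convex[OF conv] pq by (auto intro!: convexD)
    moreover have "\<phi> c \<le> (1 - 1/2) * \<phi> p + 1/2 * \<phi> q"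
      unfolding c_def by (rule convex_onD[OF conv]) (use pq in auto)
    ultimately show ?thesis
      using m[of c] norm_midpoint_sq[of p q x] unfolding J_def c_def by (simp add: field_simps)
  qed
  have "Cauchy X"
  proof (rule metric_CauchyI)
    fix e :: real assume e: "e > 0"
    then have "\<forall>\<^sub>F n in sequentially. 1 / real (Suc n) < e\<^sup>2 / 8"
      by (intro order_tendstoD(2)[OF lim]) auto
    then obtain N where N: "\<And>n. n \<ge> N \<Longrightarrow> 1 / real (Suc n) < e\<^sup>2 / 8"
      unfolding eventually_sequentially by blast
    have near: "J (X n) - m < e\<^sup>2 / 8" if "n \<ge> N" for n
    proof -
      have "J (X n) < m + 1 / real (Suc n)" by (rule X(2))
      also have "\<dots> < m + e\<^sup>2 / 8" by (rule add_strict_left_mono[OF N[OF that]])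
      finally show ?thesis by (simp only: less_diff_eq diff_less_eq add.commute)
    qed
    have "dist (X i) (X j) < e" if ij: "i \<ge> N" "j \<ge> N" for i j
    proof -
      have "(norm (X i - X j))\<^sup>2 \<le> 4 * (J (X i) - m) + 4 * (J (X j) - m)"
        by (rule mid[OF X(1) X(1)])
      also have "\<dots> < 4 * (e\<^sup>2 / 8) + 4 * (e\<^sup>2 / 8)"
        by (intro add_strict_mono mult_strict_left_mono near ij) simp_all
      finally have "(norm (X i - X j))\<^sup>2 < e\<^sup>2" by simp
      then show ?thesis
        unfolding dist_norm by (rule power2_less_imp_less) (use e in simp)
    qed
    then show "\<exists>N. \<forall>i\<ge>N. \<forall>j\<ge>N. dist (X i) (X j) < e" by blast
  qed
  then obtain z where z: "X \<longlonglongrightarrow> z" using Cauchy_convergent convergent_def by blast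
  have zC: "z \<in> C" using closed_sequentially[OF assms(2)] X(1) z by blast
  have "\<phi> z \<le> m + 0 - 1 / 2 * (norm (z - x))\<^sup>2"
  proof (rule lsc_on_tendsto_le[OF lsc zC z X(1)])
    show "(\<lambda>n. m + 1 / real (Suc n) - 1 / 2 * (norm (X n - x))\<^sup>2)
        \<longlonglongrightarrow> m + 0 - 1 / 2 * (norm (z - x))\<^sup>2"
      by (intro tendsto_intros lim z)
    show "\<phi> (X n) \<le> m + 1 / real (Suc n) - 1 / 2 * (norm (X n - x))\<^sup>2" for n
      using X(2)[of n] unfolding J_def by simp
  qed
  then have "J z \<le> m" by (simp add: J_def)
  then show thesis using that[OF zC] m unfolding J_def by (meson order_trans)
qed

text \<open>
  Minimality is tested on the segment from \<open>z\<close> to \<open>v\<close>: after division by the parameter \<open>l\<close> the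
  quadratic term still carries a factor \<open>l\<close> and vanishes as \<open>l\<close> tends to \<open>0\<close>.
\<close>
lemma prox_variational:
  fixes C :: "'a::real_inner set"
  assumes conv: "convex_on C \<phi>" and z: "z \<in> C"
    and min: "\<And>v. v \<in> C \<Longrightarrow> \<phi> z + 1 / 2 * (norm (z - x))\<^sup>2 \<le> \<phi> v + 1 / 2 * (norm (v - x))\<^sup>2"
    and v: "v \<in> C"
  shows "(x - z) \<bullet> (v - z) \<le> \<phi> v - \<phi> z"
proof -
  have *: "(x - z) \<bullet> (v - z) \<le> \<phi> v - \<phi> z + l / 2 * (norm (v - z))\<^sup>2" if l: "0 < l" "l < 1" for l :: real
  proof -
    define p where "p = (1 - l) *\<^sub>R z + l *\<^sub>R v"
    have "p \<in> C"
      unfolding p_def using convex_on_imp_convex[OF conv] v z l by (auto intro: convexD_alt)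
    from min[OF this] have "\<phi> z + 1 / 2 * (norm (z - x))\<^sup>2 \<le> \<phi> p + 1 / 2 * (norm (p - x))\<^sup>2" .
    moreover have "\<phi> p \<le> (1 - l) * \<phi> z + l * \<phi> v"
      unfolding p_def using convex_onD[OF conv] l v z by simp
    moreover have "(norm (p - x))\<^sup>2
        = (norm (z - x))\<^sup>2 - 2 * l * ((x - z) \<bullet> (v - z)) + l\<^sup>2 * (norm (v - z))\<^sup>2"
    proof -
      have "p - x = (z - x) + l *\<^sub>R (v - z)" by (simp add: p_def algebra_simps)
      then show ?thesis
        by (simp only: power2_norm_eq_inner)
          (simp add: inner_commute power2_eq_square algebra_simps)
    qed
    ultimately have "l * ((x - z) \<bullet> (v - z)) \<le> l * (\<phi> v - \<phi> z + l / 2 * (norm (v - z))\<^sup>2)"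
      by (simp add: algebra_simps power2_eq_square)
    then show ?thesis using l(1) by simp
  qed
  have "((\<lambda>l. \<phi> v - \<phi> z + l / 2 * (norm (v - z))\<^sup>2)
      \<longlongrightarrow> \<phi> v - \<phi> z + 0 / 2 * (norm (v - z))\<^sup>2) (at_right 0)"
    by (intro tendsto_intros) simp
  moreover have "\<forall>\<^sub>F l in at_right (0::real). (x - z) \<bullet> (v - z) \<le> \<phi> v - \<phi> z + l / 2 * (norm (v - z))\<^sup>2"
    by (rule eventually_mono[OF eventually_at_right_real[of 0 1]]) (use * in auto)
  ultimately have "(x - z) \<bullet> (v - z) \<le> \<phi> v - \<phi> z + 0 / 2 * (norm (v - z))\<^sup>2"
    by (rule tendsto_lowerbound) simp
  then show ?thesis by simp
qed

lemma prox_arg_min_on: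
  fixes C :: "'a::{real_inner, banach} set"
  assumes "C \<noteq> {}" "closed C" "convex_on C \<phi>" "lsc_on C \<phi>"
    and z: "z = arg_min_on (\<lambda>v. \<phi> v + 1 / 2 * (norm (v - x))\<^sup>2) C"
  shows "z \<in> C" "\<And>v. v \<in> C \<Longrightarrow> (x - z) \<bullet> (v - z) \<le> \<phi> v - \<phi> z"
proof -
  let ?J = "\<lambda>v. \<phi> v + 1 / 2 * (norm (v - x))\<^sup>2"
  obtain w where "w \<in> C" "\<And>v. v \<in> C \<Longrightarrow> ?J w \<le> ?J v"
    using prox_exists[OF assms(1-4)] by blast
  then have "\<exists>w. is_arg_min ?J (\<lambda>v. v \<in> C) w"
    unfolding is_arg_min_linorder by blast
  then have "is_arg_min ?J (\<lambda>v. v \<in> C) z"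
    unfolding z arg_min_on_def arg_min_def by (rule someI_ex)
  then have z': "z \<in> C" "\<And>v. v \<in> C \<Longrightarrow> ?J z \<le> ?J v"
    unfolding is_arg_min_linorder by auto
  show "z \<in> C" by (rule z')
  show "(x - z) \<bullet> (v - z) \<le> \<phi> v - \<phi> z" if "v \<in> C" for v
    by (rule prox_variational[OF assms(3) z' that])
qed

text \<open>
  The metric projection is the proximal point of the zero function, and the variational inequality at
  two candidates for it forces them to coincide.
\<close>
lemma metric_proj:
  fixes D :: "'a::{real_inner, banach} set"
  assumes D: "D \<noteq> {}" "closed D" "convex D"
  shows metric_proj_in: "metric_proj D x \<in> D"
    and metric_proj_inner_le: "\<And>v. v \<in> D \<Longrightarrow> (x - metric_proj D x) \<bullet> (v - metric_proj D x) \<le> 0"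
proof -
  have conv: "convex_on D (\<lambda>_. 0)" using D(3) by (auto intro: convex_onI)
  have var: "(x - p) \<bullet> (v - p) \<le> 0"
    if p: "p \<in> D" "\<forall>y\<in>D. norm (x - p) \<le> norm (x - y)" and v: "v \<in> D" for p v
  proof -
    have "0 + 1 / 2 * (norm (p - x))\<^sup>2 \<le> 0 + 1 / 2 * (norm (y - x))\<^sup>2" if "y \<in> D" for y
      using p(2) that by (simp add: norm_minus_commute[of x] power_mono)
    from prox_variational[OF conv p(1) this v] show ?thesis by simp
  qed
  obtain p where p: "p \<in> D" "\<And>v. v \<in> D \<Longrightarrow> 0 + 1 / 2 * (norm (p - x))\<^sup>2 \<le> 0 + 1 / 2 * (norm (v - x))\<^sup>2"
  proof (rule prox_exists[OF D(1,2) conv])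
    show "lsc_on D (\<lambda>_. 0)"
      unfolding lsc_on_def by (auto intro: Liminf_bounded)
  qed blast
  have p2: "\<forall>y\<in>D. norm (x - p) \<le> norm (x - y)"
    using p(2) by (simp add: norm_minus_commute[of x])
  have "metric_proj D x \<in> D \<and> (\<forall>y\<in>D. norm (x - metric_proj D x) \<le> norm (x - y))"
    unfolding metric_proj_def
  proof (rule theI)
    show "p \<in> D \<and> (\<forall>y\<in>D. norm (x - p) \<le> norm (x - y))" using p(1) p2 by blast
    fix q assume q: "q \<in> D \<and> (\<forall>y\<in>D. norm (x - q) \<le> norm (x - y))"
    have "(x - p) \<bullet> (q - p) \<le> 0" "(x - q) \<bullet> (p - q) \<le> 0"
      using var p(1) p2 q by blast+
    then have "(q - p) \<bullet> (q - p) \<le> 0" by (simp add: algebra_simps inner_commute)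
    then show "q = p" by (metis inner_eq_zero_iff inner_ge_zero order_antisym right_minus_eq)
  qed
  then show "metric_proj D x \<in> D"
    "\<And>v. v \<in> D \<Longrightarrow> (x - metric_proj D x) \<bullet> (v - metric_proj D x) \<le> 0"
    using var by blast+
qed

text \<open>
  The angle at the projection is obtuse, so the law of cosines has a favourable sign.
\<close>
lemma metric_proj_dist_sq_le:
  fixes D :: "'a::{real_inner, banach} set"
  assumes "D \<noteq> {}" "closed D" "convex D" "v \<in> D"
  shows "(norm (v - metric_proj D x))\<^sup>2 \<le> (norm (v - x))\<^sup>2 - (norm (metric_proj D x - x))\<^sup>2"
  using metric_proj_inner_le[OF assms, of x]
  by (simp add: power2_norm_eq_inner algebra_simps inner_commute)

section \<open>Adjoints\<close>

text \<open>
  The representing vector is a multiple of the point \<open>p\<close> of least norm in the affine hyperplane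
  \<open>\<phi> = 1\<close>, because \<open>p\<close> is orthogonal to the kernel of \<open>\<phi>\<close>.
\<close>
lemma riesz_representation:
  fixes \<phi> :: "'a::{real_inner, banach} \<Rightarrow> real"
  assumes "bounded_linear \<phi>"
  obtains w where "\<And>x. \<phi> x = x \<bullet> w"
proof (cases "\<exists>x. \<phi> x \<noteq> 0")
  case False
  then show thesis using that[of 0] by simp
next
  case True
  interpret bounded_linear \<phi> by (rule assms)
  define D where "D = {x. \<phi> x = 1}"
  obtain x0 where x0: "\<phi> x0 \<noteq> 0" using True by blast
  have D: "D \<noteq> {}" "closed D" "convex D"
  proof -
    have "(1 / \<phi> x0) *\<^sub>R x0 \<in> D" using x0 by (simp add: D_def scaleR)
    then show "D \<noteq> {}" by blast
    show "closed D" unfolding D_def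
      by (intro closed_Collect_eq continuous_intros continuous_on)
    show "convex D" unfolding D_def convex_def by (auto simp: add scaleR)
  qed
  define p where "p = metric_proj D 0"
  have p: "\<phi> p = 1" using metric_proj_in[OF D] by (auto simp: p_def D_def)
  have p0: "p \<bullet> p \<noteq> 0" using p zero by (metis inner_eq_zero_iff zero_neq_one)
  have le: "p \<bullet> y \<ge> 0" if "\<phi> y = 0" for y
  proof -
    have "p + y \<in> D" using that p by (simp add: D_def add)
    from metric_proj_inner_le[OF D this, of 0] show ?thesis
      unfolding p_def[symmetric] by simp
  qed
  have orth: "p \<bullet> y = 0" if "\<phi> y = 0" for y
    using le[of y] le[of "- y"] that by (simp add: neg)
  have "\<phi> x = x \<bullet> ((1 / (p \<bullet> p)) *\<^sub>R p)" for x
    using orth[of "x - \<phi> x *\<^sub>R p"] p p0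
    by (simp add: diff scaleR inner_diff_right inner_commute field_simps)
  then show thesis by (rule that)
qed

text \<open>
  The adjoint is defined by choice, so it has its characteristic property once some map has it; the
  Riesz representation of \<open>x \<mapsto> A x \<bullet> y\<close> supplies one.
\<close>
lemma inner_adjoint:
  fixes A :: "'a::{real_inner, banach} \<Rightarrow> 'b::real_inner"
  assumes "bounded_linear A"
  shows "x \<bullet> adjoint A y = A x \<bullet> y"
proof -
  have "\<exists>w. \<forall>x. A x \<bullet> y = x \<bullet> w" for y
  proof -
    have "bounded_linear (\<lambda>x. A x \<bullet> y)"
      by (rule bounded_linear_compose[OF bounded_linear_inner_left assms])
    then show ?thesis by (rule riesz_representation) blast
  qed
  then have "\<exists>h. \<forall>x y. A x \<bullet> y = x \<bullet> h y" by metis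
  then have "\<forall>x y. A x \<bullet> y = x \<bullet> adjoint A y"
    unfolding adjoint_def by (rule someI_ex)
  then show ?thesis by simp
qed

lemma norm_adjoint_le:
  fixes A :: "'a::{real_inner, banach} \<Rightarrow> 'b::real_inner"
  assumes "bounded_linear A"
  shows "norm (adjoint A y) \<le> onorm A * norm y"
proof (cases "adjoint A y = 0")
  case True
  then show ?thesis using onorm_pos_le[OF assms] by simp
next
  case False
  have "norm (adjoint A y) * norm (adjoint A y) = A (adjoint A y) \<bullet> y"
    using inner_adjoint[OF assms, of "adjoint A y" y]
    by (simp add: power2_norm_eq_inner[symmetric] power2_eq_square)
  also have "\<dots> \<le> norm (A (adjoint A y)) * norm y" by (rule norm_cauchy_schwarz)
  also have "\<dots> \<le> onorm A * norm (adjoint A y) * norm y"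
    using onorm[OF assms] by (intro mult_right_mono) auto
  finally have "norm (adjoint A y) * norm (adjoint A y) \<le> (onorm A * norm y) * norm (adjoint A y)"
    by (simp add: mult_ac)
  then show ?thesis using False by simp
qed

section \<open>Nested convex sets\<close>
lemma convergent_if_dist_sq_le_increment:
  fixes X :: "nat \<Rightarrow> 'a::{real_inner, banach}"
  assumes inc: "\<And>m n. n \<le> m \<Longrightarrow> (norm (X m - X n))\<^sup>2 \<le> r m - r n" and bound: "\<And>n. r n \<le> R"
  shows "convergent X"
proof -
  have mono: "incseq r"
    unfolding incseq_def using inc by (smt (verit) zero_le_power2)
  obtain L where L: "r \<longlonglongrightarrow> L" "\<forall>n. r n \<le> L"
    using incseq_convergent[OF mono, of R] bound by blast
  have "Cauchy X"
  proof (rule metric_CauchyI)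
    fix e :: real assume e: "e > 0"
    then have "\<forall>\<^sub>F n in sequentially. L - (e / 2)\<^sup>2 < r n"
      using L(1) by (intro order_tendstoD) auto
    then obtain N where N: "L - (e / 2)\<^sup>2 < r N"
      by (auto simp: eventually_sequentially)
    have near: "norm (X i - X N) < e / 2" if "i \<ge> N" for i
    proof -
      have "(norm (X i - X N))\<^sup>2 < (e / 2)\<^sup>2"
        using inc[OF that] N L(2) by (smt (verit))
      then show ?thesis using e by (intro power2_less_imp_less[of _ "e / 2"]) auto
    qed
    have "dist (X i) (X j) < e" if "i \<ge> N" "j \<ge> N" for i j
      using near[OF that(1)] near[OF that(2)] dist_triangle_half_l[of "X i" "X N" e "X j"]
      by (simp add: dist_norm norm_minus_commute)
    then show "\<exists>N. \<forall>i\<ge>N. \<forall>j\<ge>N. dist (X i) (X j) < e" by blast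
  qed
  then show ?thesis by (rule Cauchy_convergent)
qed

lemma metric_proj_decreasing_convergent:
  fixes D :: "nat \<Rightarrow> 'a::{real_inner, banach} set"
  assumes cc: "\<And>n. closed (D n)" "\<And>n. convex (D n)"
    and dec: "\<And>m n. n \<le> m \<Longrightarrow> D m \<subseteq> D n" and q: "\<And>n. q \<in> D n"
  shows "convergent (\<lambda>n. metric_proj (D n) x)"
proof (rule convergent_if_dist_sq_le_increment)
  let ?p = "\<lambda>n. metric_proj (D n) x"
  have ne: "D n \<noteq> {}" for n using q by blast
  show "(norm (?p m - ?p n))\<^sup>2 \<le> (norm (?p m - x))\<^sup>2 - (norm (?p n - x))\<^sup>2" if "n \<le> m" for m n
    using metric_proj_dist_sq_le[OF ne cc, of "?p m" n x] metric_proj_in[OF ne cc, of m x] dec[OF that]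
    by blast
  show "(norm (?p n - x))\<^sup>2 \<le> (norm (q - x))\<^sup>2" for n
    using metric_proj_dist_sq_le[OF ne cc q, of n x] by (smt (verit) zero_le_power2)
qed

text \<open>
  This is weak compactness of bounded closed convex sets without the weak topology. The points of least
  norm of larger and larger finite intersections, chosen so that their squared norms approach the supremum \<open>D\<close>,
  form a Cauchy sequence. Adjoining any further set \<open>X\<close> of the family cannot raise these beyond \<open>D\<close>,
  so it moves these points by an amount that tends to \<open>0\<close>, and the limit lies in \<open>X\<close>.
\<close>
lemma closed_convex_bounded_fip:
  fixes F :: "'a::{real_inner, banach} set set"
  assumes cc: "\<And>X. X \<in> F \<Longrightarrow> closed X" "\<And>X. X \<in> F \<Longrightarrow> convex X"
    and B: "B \<in> F" "bounded B"
    and fip: "\<And>G. finite G \<Longrightarrow> G \<subseteq> F \<Longrightarrow> \<Inter>G \<noteq> {}"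
  shows "\<Inter>F \<noteq> {}"
proof -
  define p where "p G = metric_proj (\<Inter>G) (0::'a)" for G
  define \<G> where "\<G> = {G. finite G \<and> G \<subseteq> F \<and> B \<in> G}"
  have G: "\<Inter>G \<noteq> {}" "closed (\<Inter>G)" "convex (\<Inter>G)" if "G \<in> \<G>" for G
    using that fip cc unfolding \<G>_def by (auto intro!: closed_Inter convex_Inter)
  have p: "p G \<in> \<Inter>G" if "G \<in> \<G>" for G
    unfolding p_def by (rule metric_proj_in[OF G[OF that]])
  have step: "(norm (p H - p G))\<^sup>2 \<le> (norm (p H))\<^sup>2 - (norm (p G))\<^sup>2"
    if "G \<in> \<G>" "H \<in> \<G>" "G \<subseteq> H" for G H
  proof -
    have "p H \<in> \<Inter>G" using p[OF that(2)] that(3) by blast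
    from metric_proj_dist_sq_le[OF G[OF that(1)] this, of 0] show ?thesis by (simp add: p_def)
  qed
  obtain R where R: "\<And>x. x \<in> B \<Longrightarrow> norm x \<le> R"
    using B(2) by (auto simp: bounded_iff)
  define D where "D = Sup ((\<lambda>G. (norm (p G))\<^sup>2) ` \<G>)"
  have bdd: "bdd_above ((\<lambda>G. (norm (p G))\<^sup>2) ` \<G>)"
  proof (rule bdd_aboveI2)
    fix G assume "G \<in> \<G>"
    then have "p G \<in> B" using p[of G] unfolding \<G>_def by blast
    then show "(norm (p G))\<^sup>2 \<le> R\<^sup>2" using R by (simp add: power_mono)
  qed
  have D: "(norm (p G))\<^sup>2 \<le> D" if "G \<in> \<G>" for G
    unfolding D_def by (rule cSUP_upper[OF that bdd])
  have "{B} \<in> \<G>" using B by (simp add: \<G>_def)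
  then have ne: "\<G> \<noteq> {}" by blast
  have "\<exists>G\<in>\<G>. D - 1 / real (Suc n) < (norm (p G))\<^sup>2" for n
    using less_cSUP_iff[OF ne bdd, of "D - 1 / real (Suc n)"] unfolding D_def by simp
  then obtain g where g: "\<And>n. g n \<in> \<G>" "\<And>n. D - 1 / real (Suc n) < (norm (p (g n)))\<^sup>2" by metis
  define h where "h n = (\<Union>i\<le>n. g i)" for n
  have h: "h n \<in> \<G>" for n using g(1) unfolding h_def \<G>_def by blast
  have h_mono: "h n \<subseteq> h m" if "n \<le> m" for m n
    unfolding h_def using that by (intro UN_mono) auto
  have ph: "D - 1 / real (Suc n) < (norm (p (h n)))\<^sup>2" for n
  proof -
    have "g n \<subseteq> h n" by (auto simp: h_def)
    then show ?thesis using step[OF g(1) h, of n n] g(2)[of n] by (smt (verit) zero_le_power2)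
  qed
  have "convergent (\<lambda>n. p (h n))"
  proof (rule convergent_if_dist_sq_le_increment)
    show "(norm (p (h m) - p (h n)))\<^sup>2 \<le> (norm (p (h m)))\<^sup>2 - (norm (p (h n)))\<^sup>2" if "n \<le> m" for m n
      by (rule step[OF h h h_mono[OF that]])
    show "(norm (p (h n)))\<^sup>2 \<le> D" for n by (rule D[OF h])
  qed
  then obtain l where l: "(\<lambda>n. p (h n)) \<longlonglongrightarrow> l" by (auto simp: convergent_def)
  have "l \<in> X" if X: "X \<in> F" for X
  proof -
    define k where "k n = insert X (h n)" for n
    have k: "k n \<in> \<G>" for n using h[of n] X by (auto simp: k_def \<G>_def)
    have "(norm (p (k n) - p (h n)))\<^sup>2 \<le> 1 / real (Suc n)" for n
    proof -
      have "h n \<subseteq> k n" by (auto simp: k_def)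
      then show ?thesis using step[OF h k, of n n] D[OF k, of n] ph[of n] by linarith
    qed
    then have "(\<lambda>n. (norm (p (k n) - p (h n)))\<^sup>2) \<longlonglongrightarrow> 0"
      by (intro tendsto_sandwich[OF _ _ tendsto_const LIMSEQ_Suc[OF lim_1_over_n]]) auto
    then have "(\<lambda>n. p (k n) - p (h n)) \<longlonglongrightarrow> 0"
      using tendsto_power_zero by (simp add: tendsto_norm_zero_iff tendsto_null_power)
    from tendsto_add[OF this l] have "(\<lambda>n. p (k n)) \<longlonglongrightarrow> l" by simp
    moreover have "p (k n) \<in> X" for n using p[OF k, of n] by (auto simp: k_def)
    ultimately show ?thesis using closed_sequentially[OF cc(1)[OF X], of "\<lambda>n. p (k n)" l] by blast
  qed
  then show ?thesis by blast
qed

section \<open>A theorem of the alternative for convex functions\<close>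

text \<open>
  The pairs that lie strictly above some value of \<open>(h1, h2)\<close> form a convex subset of the plane that
  misses the origin. A line through the origin bounds it, and as the set is unbounded upwards in
  both coordinates, the normal of this line has nonnegative entries, which are the multipliers up to scaling.
\<close>
lemma convex_alternative_pair:
  fixes h1 h2 :: "'a::real_vector \<Rightarrow> real"
  assumes c1: "convex_on K h1" and c2: "convex_on K h2"
    and no: "\<And>w. w \<in> K \<Longrightarrow> h1 w < 0 \<Longrightarrow> h2 w < 0 \<Longrightarrow> False"
  obtains l where "0 \<le> l" "l \<le> 1" "\<And>w. w \<in> K \<Longrightarrow> l * h1 w + (1 - l) * h2 w \<ge> 0"
proof (cases "K = {}")
  case True
  then show thesis using that[of 0] by simp
next
  case False
  then obtain w0 where w0: "w0 \<in> K" by blast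
  define E where "E = {r :: real \<times> real. \<exists>w\<in>K. h1 w < fst r \<and> h2 w < snd r}"
  have "convex E"
  proof (rule convexI)
    fix r s :: "real \<times> real" and a b :: real
    assume rs: "r \<in> E" "s \<in> E" and ab: "0 \<le> a" "0 \<le> b" "a + b = 1"
    obtain v w where v: "v \<in> K" "h1 v < fst r" "h2 v < snd r"
      and w: "w \<in> K" "h1 w < fst s" "h2 w < snd s"
      using rs by (auto simp: E_def)
    let ?p = "a *\<^sub>R v + b *\<^sub>R w"
    have p: "?p \<in> K" using convex_on_imp_convex[OF c1] v(1) w(1) ab by (auto intro: convexD)
    have comb: "a * x1 + b * y1 < a * x2 + b * y2" if "x1 < x2" "y1 < y2" for x1 x2 y1 y2 :: real
    proof (cases "a = 0")
      case True then show ?thesis using ab that by simp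
    next
      case False
      then have "a * x1 < a * x2" "b * y1 \<le> b * y2" using ab that by (auto intro: mult_left_mono)
      then show ?thesis by simp
    qed
    have "h1 ?p \<le> a * h1 v + b * h1 w" "h2 ?p \<le> a * h2 v + b * h2 w"
      using c1 c2 v(1) w(1) ab unfolding convex_on_def by blast+
    moreover have "a * h1 v + b * h1 w < fst (a *\<^sub>R r + b *\<^sub>R s)"
      "a * h2 v + b * h2 w < snd (a *\<^sub>R r + b *\<^sub>R s)"
      using comb[OF v(2) w(2)] comb[OF v(3) w(3)] by auto
    ultimately show "a *\<^sub>R r + b *\<^sub>R s \<in> E"
      using p unfolding E_def mem_Collect_eq by (meson le_less_trans)
  qed
  moreover have "0 \<notin> E" using no by (auto simp: E_def)
  ultimately obtain n where n: "n \<noteq> 0" "\<And>r. r \<in> E \<Longrightarrow> 0 \<le> n \<bullet> r"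
    using separating_hyperplane_set_0[of E] by blast
  obtain a b where ab: "n = (a, b)" by (cases n)
  have sep: "0 \<le> a * r + b * s" if "w \<in> K" "h1 w < r" "h2 w < s" for w r s
    using n(2)[of "(r, s)"] that by (auto simp: E_def ab)
  have nonneg: "0 \<le> a * h1 w + b * h2 w" if w: "w \<in> K" for w
  proof -
    have "((\<lambda>e. a * (h1 w + e) + b * (h2 w + e)) \<longlongrightarrow> a * (h1 w + 0) + b * (h2 w + 0)) (at_right 0)"
      by (intro tendsto_intros)
    moreover have "\<forall>\<^sub>F e in at_right 0. 0 \<le> a * (h1 w + e) + b * (h2 w + e)"
      using eventually_at_right_less[of "0::real"] by eventually_elim (rule sep[OF w]; simp)
    ultimately have "0 \<le> a * (h1 w + 0) + b * (h2 w + 0)" by (rule tendsto_lowerbound) simp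
    then show ?thesis by simp
  qed
  have unb: "0 \<le> c" if "\<And>M. M > 0 \<Longrightarrow> 0 \<le> c * M + d" for c d :: real
  proof (rule ccontr)
    assume c: "\<not> 0 \<le> c"
    have "0 \<le> c * ((\<bar>d\<bar> + 1) / (- c)) + d" by (rule that) (use c in \<open>simp add: divide_pos_neg\<close>)
    then show False using c by simp
  qed
  have a: "0 \<le> a"
  proof (rule unb)
    fix M :: real assume "M > 0"
    then show "0 \<le> a * M + (a * h1 w0 + b * (h2 w0 + 1))"
      using sep[OF w0, of "h1 w0 + M" "h2 w0 + 1"] by (simp add: algebra_simps)
  qed
  have b: "0 \<le> b"
  proof (rule unb)
    fix M :: real assume "M > 0"
    then show "0 \<le> b * M + (b * h2 w0 + a * (h1 w0 + 1))"
      using sep[OF w0, of "h1 w0 + 1" "h2 w0 + M"] by (simp add: algebra_simps)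
  qed
  have s: "a + b > 0" using a b n(1) ab by (auto simp: zero_prod_def)
  show thesis
  proof (rule that[of "a / (a + b)"])
    show "0 \<le> a / (a + b)" "a / (a + b) \<le> 1" using a b s by (auto simp: field_simps)
    fix w assume w: "w \<in> K"
    have "1 - a / (a + b) = b / (a + b)" using s by (simp add: field_simps)
    then have "a / (a + b) * h1 w + (1 - a / (a + b)) * h2 w = (a * h1 w + b * h2 w) / (a + b)"
      by (simp add: add_divide_distrib)
    then show "0 \<le> a / (a + b) * h1 w + (1 - a / (a + b)) * h2 w" using nonneg[OF w] s by simp
  qed
qed

lemma convex_on_weighted_sum:
  fixes h :: "'i \<Rightarrow> 'a::real_vector \<Rightarrow> real"
  assumes "finite V" "convex K" "\<And>v. v \<in> V \<Longrightarrow> convex_on K (h v)" "\<And>v. v \<in> V \<Longrightarrow> 0 \<le> c v"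
  shows "convex_on K (\<lambda>w. \<Sum>v\<in>V. c v * h v w)"
  using assms
  by (induction V rule: finite_induct) (auto simp: convex_on_const intro!: convex_on_add convex_on_cmul)

text \<open>
  Induction over \<open>V\<close> keeps all separation in the plane: the hypothesis is applied to the part of \<open>K\<close>
  where the new function is negative, and the resulting combination and the new function form a pair
  without a common negative point.
\<close>
lemma convex_alternative:
  fixes h :: "'i \<Rightarrow> 'a::real_vector \<Rightarrow> real"
  assumes "finite V" "V \<noteq> {}" "\<And>v. v \<in> V \<Longrightarrow> convex_on K (h v)"
    and "\<And>w. w \<in> K \<Longrightarrow> \<exists>v\<in>V. h v w \<ge> 0"
  shows "\<exists>c. (\<forall>v\<in>V. c v \<ge> 0) \<and> sum c V = 1 \<and> (\<forall>w\<in>K. (\<Sum>v\<in>V. c v * h v w) \<ge> 0)"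
  using assms
proof (induction V arbitrary: K rule: finite_ne_induct)
  case (singleton v)
  then show ?case by (intro exI[of _ "\<lambda>_. 1"]) auto
next
  case (insert v V)
  let ?K = "{w \<in> K. h v w < 0}"
  have cv: "convex_on K (h v)" using insert.prems(1) by simp
  have K': "convex ?K"
  proof (rule convexI)
    fix x y :: 'a and a b :: real
    assume xy: "x \<in> ?K" "y \<in> ?K" and ab: "0 \<le> a" "0 \<le> b" "a + b = 1"
    have "h v (a *\<^sub>R x + b *\<^sub>R y) \<le> a * h v x + b * h v y"
      using cv xy ab unfolding convex_on_def by blast
    also have "\<dots> < 0"
      using xy ab by (intro convex_bound_lt) auto
    finally show "a *\<^sub>R x + b *\<^sub>R y \<in> ?K"
      using convex_on_imp_convex[OF cv] xy ab by (auto intro: convexD)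
  qed
  have "\<exists>c. (\<forall>v\<in>V. c v \<ge> 0) \<and> sum c V = 1 \<and> (\<forall>w\<in>?K. (\<Sum>v\<in>V. c v * h v w) \<ge> 0)"
  proof (rule insert.IH)
    show "convex_on ?K (h v')" if "v' \<in> V" for v'
      by (rule convex_on_subset[of K]) (use that insert.prems(1) K' in auto)
    show "\<exists>v\<in>V. h v w \<ge> 0" if "w \<in> ?K" for w
      using insert.prems(2)[of w] that by auto
  qed
  then obtain c where c: "\<forall>v\<in>V. c v \<ge> 0" "sum c V = 1" "\<forall>w\<in>?K. (\<Sum>v\<in>V. c v * h v w) \<ge> 0"
    by blast
  let ?h = "\<lambda>w. \<Sum>v\<in>V. c v * h v w"
  have "convex_on K ?h"
    using insert.prems(1) c(1) convex_on_imp_convex[OF cv] insert.hyps(1)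
    by (intro convex_on_weighted_sum) auto
  moreover have False if "w \<in> K" "h v w < 0" "?h w < 0" for w
    using c(3) that by force
  ultimately obtain l where l: "0 \<le> l" "l \<le> 1" "\<And>w. w \<in> K \<Longrightarrow> l * h v w + (1 - l) * ?h w \<ge> 0"
    using convex_alternative_pair[OF cv, of ?h] by blast
  define d where "d i = (if i = v then l else (1 - l) * c i)" for i
  have "(\<Sum>i\<in>V. d i) = (\<Sum>i\<in>V. (1 - l) * c i)" "(\<Sum>i\<in>V. d i * h i w) = (\<Sum>i\<in>V. (1 - l) * (c i * h i w))" for w
    using insert.hyps(3) by (auto intro!: sum.cong simp: d_def)
  then have dV: "sum d V = 1 - l" "(\<Sum>i\<in>V. d i * h i w) = (1 - l) * ?h w" for w
    using c(2) by (auto simp: sum_distrib_left[symmetric])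
  show ?case
  proof (intro exI[of _ d] conjI ballI)
    show "0 \<le> d i" if "i \<in> insert v V" for i using that l c(1) by (auto simp: d_def)
    show "sum d (insert v V) = 1" using insert.hyps dV by (simp add: d_def)
    show "0 \<le> (\<Sum>i\<in>insert v V. d i * h i w)" if "w \<in> K" for w
      using l(3)[OF that] insert.hyps dV(2)[of w] by (simp add: d_def)
  qed
qed

section \<open>Equilibrium problems for monotone bifunctions\<close>

text \<open>
  Minty's trick: at a point \<open>?p l\<close> between \<open>v\<close> and \<open>w\<close>, convexity splits \<open>g (?p l) (?p l) = 0\<close>
  into a multiple of the wanted \<open>g (?p l) v\<close> and a term bounded by the dual inequality; then \<open>l\<close> tends
  to \<open>0\<close>. The linear perturbation \<open>\<theta>\<close> serves the resolvent, whereas \<open>\<theta> = 0\<close> gives solutions of the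
  equilibrium problem itself.
\<close>
lemma minty:
  fixes Q :: "'a::real_inner set"
  assumes A: "assumptions_A Q g" and w: "w \<in> Q"
    and dual: "\<And>v. v \<in> Q \<Longrightarrow> g v w \<le> (v - w) \<bullet> \<theta>"
    and v: "v \<in> Q"
  shows "0 \<le> g w v + (v - w) \<bullet> \<theta>"
proof (rule field_le_epsilon)
  fix e :: real assume e: "e > 0"
  have conv: "convex_on Q (g p)" and diag: "g p p = 0" if "p \<in> Q" for p
    using A that unfolding assumptions_A_def by blast+
  let ?p = "\<lambda>l::real. l *\<^sub>R v + (1 - l) *\<^sub>R w"
  have low: "- (1 - l) * ((v - w) \<bullet> \<theta>) \<le> g (?p l) v" if l: "0 < l" "l < 1" for l
  proof -
    have p: "?p l \<in> Q"
      using convex_on_imp_convex[OF conv[OF w]] v w l by (auto intro: convexD)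
    have "0 = g (?p l) (?p l)" using diag[OF p] by simp
    also have "\<dots> \<le> l * g (?p l) v + (1 - l) * g (?p l) w"
      using conv[OF p] v w l unfolding convex_on_def by auto
    also have "g (?p l) w \<le> (?p l - w) \<bullet> \<theta>" by (rule dual[OF p])
    also have "?p l - w = l *\<^sub>R (v - w)" by (simp add: algebra_simps)
    finally have "0 \<le> l * g (?p l) v + (1 - l) * (l * ((v - w) \<bullet> \<theta>))"
      using l by simp
    then have "0 \<le> l * (g (?p l) v + (1 - l) * ((v - w) \<bullet> \<theta>))" by (simp add: algebra_simps)
    then have "0 \<le> g (?p l) v + (1 - l) * ((v - w) \<bullet> \<theta>)" using l by (simp add: zero_le_mult_iff)
    then show ?thesis by (simp add: left_diff_distrib)
  qed
  have "Limsup (at_right 0) (\<lambda>l. ereal (g (?p l) v)) \<le> ereal (g w v)"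
    using A v w unfolding assumptions_A_def by blast
  then have "\<forall>\<^sub>F l in at_right 0. ereal (g (?p l) v) < ereal (g w v + e)"
    unfolding Limsup_le_iff using e by (metis less_add_same_cancel1 less_ereal.simps(1))
  moreover have "\<forall>\<^sub>F l in at_right (0::real). 0 < l \<and> l < 1"
    using eventually_at_right_real[of 0 1] by (auto elim: eventually_mono)
  ultimately have "\<forall>\<^sub>F l in at_right 0. - (1 - l) * ((v - w) \<bullet> \<theta>) \<le> g w v + e"
    by eventually_elim (use low in force)
  moreover have "((\<lambda>l. - (1 - l) * ((v - w) \<bullet> \<theta>)) \<longlongrightarrow> - (1 - 0) * ((v - w) \<bullet> \<theta>)) (at_right 0)"
    by (intro tendsto_intros)
  ultimately have "- (1 - 0) * ((v - w) \<bullet> \<theta>) \<le> g w v + e"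
    by (intro tendsto_upperbound) auto
  then show "0 \<le> g w v + (v - w) \<bullet> \<theta> + e" by simp
qed

lemma convex_on_inner_diff_diff:
  fixes Q :: "'a::real_inner set"
  assumes "convex Q"
  shows "convex_on Q (\<lambda>w. (w - v) \<bullet> (w - u))"
proof (rule convex_onI)
  fix t :: real and x y :: 'a assume t: "0 < t" "t < 1"
  have "(1 - t) * ((x - v) \<bullet> (x - u)) + t * ((y - v) \<bullet> (y - u))
      - ((1 - t) *\<^sub>R x + t *\<^sub>R y - v) \<bullet> ((1 - t) *\<^sub>R x + t *\<^sub>R y - u)
      = t * (1 - t) * ((x - y) \<bullet> (x - y))"
    by (simp add: algebra_simps inner_commute)
  moreover have "0 \<le> t * (1 - t) * ((x - y) \<bullet> (x - y))" using t by simp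
  ultimately show "((1 - t) *\<^sub>R x + t *\<^sub>R y - v) \<bullet> ((1 - t) *\<^sub>R x + t *\<^sub>R y - u)
      \<le> (1 - t) * ((x - v) \<bullet> (x - u)) + t * ((y - v) \<bullet> (y - u))" by linarith
qed (rule assms)

text \<open>
  If no such point existed, nonnegative weights \<open>a\<close> of sum \<open>1\<close> would make the combination of the left
  sides at least \<open>e\<close> on all of \<open>Q\<close>. At \<open>w = (\<Sum>v\<in>V. a v *\<^sub>R v)\<close> the quadratic terms cancel, and
  the remaining double sum of \<open>a v * a v' * g v v'\<close> is nonpositive, since by monotonicity its
  symmetrisation is.
\<close>
lemma approximate_dual_solution_finite:
  fixes Q :: "'a::real_inner set"
  assumes A: "assumptions_A Q g" and Q: "Q \<noteq> {}" "convex Q" and c: "0 \<le> c"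
    and V: "finite V" "V \<subseteq> Q" and e: "e > 0"
  shows "\<exists>w\<in>Q. \<forall>v\<in>V. g v w + c * ((w - v) \<bullet> (w - u)) < e"
proof (cases "V = {}")
  case True then show ?thesis using Q by blast
next
  case False
  have conv: "convex_on Q (g v)" and mono: "\<And>w. w \<in> Q \<Longrightarrow> g v w + g w v \<le> 0" if "v \<in> Q" for v
    using A that unfolding assumptions_A_def by blast+
  define h where "h v w = g v w + c * ((w - v) \<bullet> (w - u)) + (- e)" for v w
  show ?thesis
  proof (rule ccontr)
    assume "\<not> ?thesis"
    then have no: "\<exists>v\<in>V. h v w \<ge> 0" if "w \<in> Q" for w
      using that unfolding h_def by (smt (verit, best))
    have hc: "convex_on Q (h v)" if "v \<in> V" for v
      unfolding h_def
      using that V(2) c Q(2)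
      by (intro convex_on_add convex_on_cmul convex_on_inner_diff_diff conv convex_on_const[THEN iffD2]) auto
    obtain a where a: "\<forall>v\<in>V. a v \<ge> 0" "sum a V = 1" "\<forall>w\<in>Q. (\<Sum>v\<in>V. a v * h v w) \<ge> 0"
      using convex_alternative[OF V(1) False hc no] by blast
    define w where "w = (\<Sum>v\<in>V. a v *\<^sub>R v)"
    have wQ: "w \<in> Q"
      unfolding w_def using V Q(2) a by (intro convex_sum) auto
    have "(\<Sum>v\<in>V. a v * g v w) \<le> (\<Sum>v\<in>V. a v * (\<Sum>v'\<in>V. a v' * g v v'))"
    proof (intro sum_mono mult_left_mono)
      fix v assume v: "v \<in> V"
      show "g v w \<le> (\<Sum>v'\<in>V. a v' * g v v')"
        unfolding w_def using v V a False conv by (intro convex_on_sum[where C = Q]) auto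
    qed (use a in auto)
    also have "\<dots> = (\<Sum>v\<in>V. \<Sum>v'\<in>V. a v * a v' * g v v')"
      by (simp add: sum_distrib_left mult.assoc)
    also have "\<dots> \<le> 0"
    proof -
      let ?S = "\<Sum>v\<in>V. \<Sum>v'\<in>V. a v * a v' * g v v'"
      have "?S = (\<Sum>v\<in>V. \<Sum>v'\<in>V. a v * a v' * g v' v)"
        by (subst sum.swap) (simp add: mult.commute mult.left_commute)
      then have "?S + ?S = (\<Sum>v\<in>V. \<Sum>v'\<in>V. a v * a v' * (g v v' + g v' v))"
        by (simp add: sum.distrib distrib_left)
      also have "\<dots> \<le> 0"
        using a V(2) by (intro sum_nonpos mult_nonneg_nonpos mono) auto
      finally show ?thesis by simp
    qed
    finally have 1: "(\<Sum>v\<in>V. a v * g v w) \<le> 0" .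
    have "(\<Sum>v\<in>V. a v *\<^sub>R (w - v)) = 0"
      using a(2) by (simp add: scaleR_diff_right sum_subtractf w_def[symmetric] flip: scaleR_left.sum)
    then have "(\<Sum>v\<in>V. a v * ((w - v) \<bullet> (w - u))) = 0"
      by (metis (no_types, lifting) inner_scaleR_left inner_sum_left inner_zero_left sum.cong)
    then have 2: "(\<Sum>v\<in>V. a v * (c * ((w - v) \<bullet> (w - u)))) = 0"
      by (simp add: mult.left_commute flip: sum_distrib_left)
    have 3: "(\<Sum>v\<in>V. a v * e) = e" using a(2) by (simp flip: sum_distrib_right)
    have "(\<Sum>v\<in>V. a v * h v w) = (\<Sum>v\<in>V. a v * g v w) + (\<Sum>v\<in>V. a v * (c * ((w - v) \<bullet> (w - u)))) - (\<Sum>v\<in>V. a v * e)"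
      unfolding h_def by (simp add: algebra_simps sum.distrib sum_subtractf)
    then show False using a(3) wQ 1 2 3 e by force
  qed
qed

text \<open>
  Beyond distance \<open>1\<close> from \<open>v\<close> the constant \<open>B\<close> can be absorbed into the linear term and one factor
  of the norm cancelled.
\<close>
lemma bounded_if_quadratic_le_linear:
  fixes M :: "'a::real_normed_vector set"
  assumes c: "c > 0" and le: "\<And>w. w \<in> M \<Longrightarrow> c * (norm (w - v))\<^sup>2 \<le> K * norm (w - v) + B"
  shows "bounded M"
proof -
  have "norm (w - v) \<le> 1 + (\<bar>K\<bar> + \<bar>B\<bar>) / c" if w: "w \<in> M" for w
  proof (cases "norm (w - v) \<le> 1")
    case True
    moreover have "0 \<le> (\<bar>K\<bar> + \<bar>B\<bar>) / c" using c by simp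
    ultimately show ?thesis by linarith
  next
    case False
    let ?n = "norm (w - v)"
    have "K * ?n \<le> \<bar>K\<bar> * ?n" by (intro mult_right_mono) auto
    moreover have "\<bar>B\<bar> * 1 \<le> \<bar>B\<bar> * ?n" using False by (intro mult_left_mono) auto
    ultimately have "c * ?n * ?n \<le> (\<bar>K\<bar> + \<bar>B\<bar>) * ?n"
      using le[OF w] by (simp add: power2_eq_square algebra_simps)
    then have "c * ?n \<le> \<bar>K\<bar> + \<bar>B\<bar>" by (rule mult_right_le_imp_le) (use False in linarith)
    then have "?n \<le> (\<bar>K\<bar> + \<bar>B\<bar>) / c" using c by (simp add: field_simps)
    then show ?thesis by simp
  qed
  then have "M \<subseteq> cball v (1 + (\<bar>K\<bar> + \<bar>B\<bar>) / c)"
    by (auto simp: dist_norm norm_minus_commute)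
  then show ?thesis by (rule bounded_subset[OF bounded_cball])
qed

text \<open>
  The factor \<open>c\<close> stands for the reciprocal of the resolvent parameter. The sets \<open>M v e\<close> collect the
  solutions up to \<open>e\<close> of the dual inequality at \<open>v\<close>. The dual inequality has \<open>w - u\<close> in its quadratic
  term, not \<open>v - u\<close>: this makes it a case of \<open>minty\<close>, with \<open>\<theta>\<close> a multiple of \<open>w - u\<close>, and makes each
  \<open>M v e\<close> bounded.
\<close>
lemma resolvent_exists:
  fixes Q :: "'a::{real_inner, banach} set"
  assumes A: "assumptions_A Q g" and Q: "Q \<noteq> {}" "closed Q" "convex Q" and c: "c > 0"
  shows "\<exists>w\<in>Q. \<forall>v\<in>Q. 0 \<le> g w v + c * ((v - w) \<bullet> (w - u))"
proof -
  define M where "M v e = {w \<in> Q. g v w + c * ((w - v) \<bullet> (w - u)) \<le> e}" for v e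
  define F where "F = {M v e |v e. v \<in> Q \<and> e > 0}"
  obtain v0 where v0: "v0 \<in> Q" using Q(1) by blast
  have conv: "convex_on Q (g v)" and lsc: "lsc_on Q (g v)" if "v \<in> Q" for v
    using A that unfolding assumptions_A_def by blast+
  have "\<Inter>F \<noteq> {}"
  proof (rule closed_convex_bounded_fip)
    show "closed X" if "X \<in> F" for X
      using that unfolding F_def M_def
      by (auto intro!: closed_sublevel_lsc_on_add_continuous lsc Q(2) continuous_intros)
    show "convex X" if X: "X \<in> F" for X
    proof -
      obtain v e where ve: "X = M v e" "v \<in> Q" using X by (auto simp: F_def)
      have cv: "convex_on Q (\<lambda>w. g v w + c * ((w - v) \<bullet> (w - u)))"
        using c Q(3) ve(2) by (intro convex_on_add convex_on_cmul convex_on_inner_diff_diff conv) auto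
      show ?thesis
        unfolding ve(1) M_def
      proof (rule convexI)
        fix x y :: 'a and a b :: real
        assume xy: "x \<in> {w \<in> Q. g v w + c * ((w - v) \<bullet> (w - u)) \<le> e}"
          "y \<in> {w \<in> Q. g v w + c * ((w - v) \<bullet> (w - u)) \<le> e}"
          and ab: "0 \<le> a" "0 \<le> b" "a + b = 1"
        let ?k = "\<lambda>w. g v w + c * ((w - v) \<bullet> (w - u))"
        have "?k (a *\<^sub>R x + b *\<^sub>R y) \<le> a * ?k x + b * ?k y"
          using cv xy ab unfolding convex_on_def by blast
        also have "\<dots> \<le> e" using xy ab by (intro convex_bound_le) auto
        finally show "a *\<^sub>R x + b *\<^sub>R y \<in> {w \<in> Q. ?k w \<le> e}"
          using convexD[OF Q(3)] xy ab by auto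
      qed
    qed
    show "M v0 1 \<in> F" using v0 by (force simp: F_def)
    show "bounded (M v0 1)"
    proof -
      obtain K where K: "K \<ge> 0" "\<And>w. w \<in> Q \<Longrightarrow> g v0 v0 - 1 - K * norm (w - v0) \<le> g v0 w"
        using convex_on_lsc_lower_bound[OF conv[OF v0] lsc[OF v0] v0] by blast
      show ?thesis
      proof (rule bounded_if_quadratic_le_linear[OF c])
        fix w assume w: "w \<in> M v0 1"
        have "(w - v0) \<bullet> (w - u) = (norm (w - v0))\<^sup>2 + (w - v0) \<bullet> (v0 - u)"
          by (simp add: power2_norm_eq_inner algebra_simps inner_commute)
        moreover have "- ((w - v0) \<bullet> (v0 - u)) \<le> norm (w - v0) * norm (v0 - u)"
          using Cauchy_Schwarz_ineq2[of "w - v0" "v0 - u"] by linarith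
        ultimately have "(norm (w - v0))\<^sup>2 \<le> (w - v0) \<bullet> (w - u) + norm (w - v0) * norm (v0 - u)"
          by linarith
        then have "c * (norm (w - v0))\<^sup>2 \<le> c * ((w - v0) \<bullet> (w - u)) + c * (norm (w - v0) * norm (v0 - u))"
          using c by (simp flip: distrib_left)
        moreover have "g v0 w + c * ((w - v0) \<bullet> (w - u)) \<le> 1" "w \<in> Q"
          using w by (auto simp: M_def)
        ultimately show "c * (norm (w - v0))\<^sup>2 \<le> (K + c * norm (v0 - u)) * norm (w - v0) + (2 - g v0 v0)"
          using K(2)[of w] by (simp add: algebra_simps)
      qed
    qed
    show "\<Inter>G \<noteq> {}" if G: "finite G" "G \<subseteq> F" for G
    proof -
      have "\<forall>X\<in>G. \<exists>v e. X = M v e \<and> v \<in> Q \<and> e > 0"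
        using G(2) unfolding F_def by blast
      then obtain vv ee where ve: "\<And>X. X \<in> G \<Longrightarrow> X = M (vv X) (ee X) \<and> vv X \<in> Q \<and> ee X > 0"
        by metis
      \<comment> \<open>The number \<open>1\<close> is inserted for the case that \<open>G\<close> is empty.\<close>
      define e where "e = Min (insert 1 (ee ` G))"
      have e: "e > 0" "\<And>X. X \<in> G \<Longrightarrow> e \<le> ee X"
        using G(1) ve by (auto simp: e_def)
      obtain w where w: "w \<in> Q" "\<forall>v\<in>vv ` G. g v w + c * ((w - v) \<bullet> (w - u)) < e"
        using approximate_dual_solution_finite[OF A Q(1,3), of c "vv ` G" e u] c G(1) ve e(1) by auto
      have "w \<in> X" if X: "X \<in> G" for X
      proof -
        have "w \<in> M (vv X) (ee X)" using w X e(2)[OF X] unfolding M_def by force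
        then show ?thesis using ve[OF X] by simp
      qed
      then show ?thesis by blast
    qed
  qed
  then obtain w where w: "\<And>v e. v \<in> Q \<Longrightarrow> e > 0 \<Longrightarrow> w \<in> M v e"
    unfolding F_def by blast
  have wQ: "w \<in> Q" using w[OF v0, of 1] by (simp add: M_def)
  have dual: "g v w \<le> (v - w) \<bullet> (c *\<^sub>R (w - u))" if v: "v \<in> Q" for v
  proof (rule field_le_epsilon)
    fix e :: real assume "e > 0"
    then have "g v w + c * ((w - v) \<bullet> (w - u)) \<le> e" using w[OF v] by (simp add: M_def)
    then show "g v w \<le> (v - w) \<bullet> (c *\<^sub>R (w - u)) + e" by (simp add: algebra_simps)
  qed
  show ?thesis using minty[OF A wQ dual] wQ by auto
qed

lemma resolvent:
  fixes Q :: "'a::{real_inner, banach} set"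
  assumes A: "assumptions_A Q g" and Q: "Q \<noteq> {}" "closed Q" "convex Q" and c: "c > 0"
  shows resolvent_in: "resolvent Q g c u \<in> Q"
    and resolvent_ineq: "\<And>v. v \<in> Q \<Longrightarrow>
      0 \<le> g (resolvent Q g c u) v + 1 / c * ((v - resolvent Q g c u) \<bullet> (resolvent Q g c u - u))"
proof -
  let ?P = "\<lambda>w. w \<in> Q \<and> (\<forall>v\<in>Q. g w v + 1 / c * ((v - w) \<bullet> (w - u)) \<ge> 0)"
  obtain w where w: "?P w"
    using resolvent_exists[OF A Q, of "1 / c" u] c by auto
  have "?P (resolvent Q g c u)"
    unfolding resolvent_def
  proof (rule theI)
    show "?P w" by (rule w)
    fix w' assume w': "?P w'"
    have "g w w' + g w' w \<le> 0" using A w w' unfolding assumptions_A_def by blast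
    moreover have "0 \<le> g w w' + 1 / c * ((w' - w) \<bullet> (w - u))"
      "0 \<le> g w' w + 1 / c * ((w - w') \<bullet> (w' - u))" using w w' by blast+
    ultimately have "0 \<le> 1 / c * ((w' - w) \<bullet> (w - u) + (w - w') \<bullet> (w' - u))"
      unfolding distrib_left by linarith
    then have "0 \<le> (w' - w) \<bullet> (w - u) + (w - w') \<bullet> (w' - u)"
      using c by (simp add: zero_le_divide_iff)
    then have "(w' - w) \<bullet> (w' - w) \<le> 0" by (simp add: algebra_simps inner_commute)
    then show "w' = w" by (metis inner_eq_zero_iff inner_ge_zero order_antisym right_minus_eq)
  qed
  then show "resolvent Q g c u \<in> Q" "\<And>v. v \<in> Q \<Longrightarrow>
      0 \<le> g (resolvent Q g c u) v + 1 / c * ((v - resolvent Q g c u) \<bullet> (resolvent Q g c u - u))"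
    by blast+
qed

text \<open>
  The inequality defining the resolvent is tested at the solution \<open>q\<close>, where monotonicity removes \<open>g\<close>.
\<close>
lemma resolvent_dist_sq_le:
  fixes Q :: "'a::{real_inner, banach} set"
  assumes A: "assumptions_A Q g" and Q: "Q \<noteq> {}" "closed Q" "convex Q" and c: "c > 0"
    and q: "q \<in> sol_set Q g"
  shows "(norm (resolvent Q g c u - q))\<^sup>2 \<le> (norm (u - q))\<^sup>2 - (norm (resolvent Q g c u - u))\<^sup>2"
proof -
  let ?w = "resolvent Q g c u"
  have w: "?w \<in> Q" by (rule resolvent_in[OF A Q c])
  have qQ: "q \<in> Q" using q by (simp add: sol_set_def)
  have "0 \<le> g q ?w" using q w by (simp add: sol_set_def)
  moreover have "g q ?w + g ?w q \<le> 0" using A w qQ unfolding assumptions_A_def by blast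
  ultimately have "0 \<le> 1 / c * ((q - ?w) \<bullet> (?w - u))"
    using resolvent_ineq[OF A Q c qQ, of u] by linarith
  then have "0 \<le> (q - ?w) \<bullet> (?w - u)" using c by (simp add: zero_le_divide_iff)
  then show ?thesis by (simp add: power2_norm_eq_inner algebra_simps inner_commute)
qed

section \<open>One step of the iteration\<close>

text \<open>
  The variational inequalities of \<open>z\<close> at \<open>q\<close> and of \<open>y\<close> at \<open>z\<close> are added. Pseudomonotonicity disposes
  of \<open>f y q\<close>, and the Lipschitz-type condition trades the other three values of \<open>f\<close> for the squared
  distances with factors \<open>c1\<close> and \<open>c2\<close>; expanding the inner products gives the estimate.
\<close>
lemma extragradient_dist_sq_le:
  fixes C :: "'a::{real_inner, banach} set"
  assumes C: "C \<noteq> {}" "closed C" "convex C" and B: "assumptions_B C f c1 c2" and l: "l > 0"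
    and x: "x \<in> C" and q: "q \<in> sol_set C f"
    and y: "y = arg_min_on (\<lambda>v. l * f x v + 1 / 2 * (norm (v - x))\<^sup>2) C"
    and z: "z = arg_min_on (\<lambda>v. l * f y v + 1 / 2 * (norm (v - x))\<^sup>2) C"
  shows "y \<in> C" "z \<in> C" "\<And>v. v \<in> C \<Longrightarrow> (x - y) \<bullet> (v - y) \<le> l * f x v - l * f x y"
    and "(norm (z - q))\<^sup>2 \<le> (norm (x - q))\<^sup>2
      - (1 - 2 * l * c1) * (norm (x - y))\<^sup>2 - (1 - 2 * l * c2) * (norm (y - z))\<^sup>2"
proof -
  have conv: "convex_on C (\<lambda>v. l * f p v)" and lsc: "lsc_on C (\<lambda>v. l * f p v)" if p: "p \<in> C" for p
  proof -
    have cs: "convex_on C (f p)" "subdifferentiable_on C (f p)"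
      using B p unfolding assumptions_B_def by blast+
    show "convex_on C (\<lambda>v. l * f p v)" using cs(1) l by (intro convex_on_cmul) auto
    show "lsc_on C (\<lambda>v. l * f p v)"
    proof (rule subdifferentiable_on_imp_lsc_on)
      show "subdifferentiable_on C (\<lambda>v. l * f p v)"
        unfolding subdifferentiable_on_def
      proof
        fix a assume "a \<in> C"
        then obtain w where "\<forall>b\<in>C. f p b \<ge> f p a + w \<bullet> (b - a)"
          using cs(2) unfolding subdifferentiable_on_def subdifferential_on_def by blast
        then have "\<forall>b\<in>C. l * f p b \<ge> l * (f p a + w \<bullet> (b - a))" using l by simp
        then have "l *\<^sub>R w \<in> subdifferential_on C (\<lambda>v. l * f p v) a"
          by (simp add: subdifferential_on_def algebra_simps)
        then show "subdifferential_on C (\<lambda>v. l * f p v) a \<noteq> {}" by blast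
      qed
    qed
  qed
  note y' = prox_arg_min_on[OF C(1,2) conv[OF x] lsc[OF x] y]
  show yC: "y \<in> C" by (rule y'(1))
  note z' = prox_arg_min_on[OF C(1,2) conv[OF yC] lsc[OF yC] z]
  show zC: "z \<in> C" by (rule z'(1))
  show "\<And>v. v \<in> C \<Longrightarrow> (x - y) \<bullet> (v - y) \<le> l * f x v - l * f x y" by (rule y'(2))
  have qC: "q \<in> C" and "0 \<le> f q y" using q yC by (auto simp: sol_set_def)
  then have "f y q \<le> 0" using B yC unfolding assumptions_B_def by blast
  then have "l * f y q \<le> 0" using l by (simp add: mult_nonneg_nonpos)
  moreover have "(x - z) \<bullet> (q - z) \<le> l * f y q - l * f y z" by (rule z'(2)[OF qC])
  moreover have "(x - y) \<bullet> (z - y) \<le> l * f x z - l * f x y" by (rule y'(2)[OF zC])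
  moreover have "l * (f x z - c1 * (norm (x - y))\<^sup>2 - c2 * (norm (y - z))\<^sup>2) \<le> l * (f x y + f y z)"
    using B x yC zC l unfolding assumptions_B_def by (intro mult_left_mono) auto
  ultimately have main: "(x - z) \<bullet> (q - z) + (x - y) \<bullet> (z - y)
      \<le> l * c1 * (norm (x - y))\<^sup>2 + l * c2 * (norm (y - z))\<^sup>2"
    by (simp add: algebra_simps)
  have "2 * ((x - z) \<bullet> (q - z)) = (norm (x - z))\<^sup>2 + (norm (z - q))\<^sup>2 - (norm (x - q))\<^sup>2"
    by (simp add: power2_norm_eq_inner algebra_simps inner_commute)
  moreover have "2 * ((x - y) \<bullet> (z - y)) = (norm (x - y))\<^sup>2 + (norm (y - z))\<^sup>2 - (norm (x - z))\<^sup>2"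
    by (simp add: power2_norm_eq_inner algebra_simps inner_commute)
  ultimately show "(norm (z - q))\<^sup>2 \<le> (norm (x - q))\<^sup>2
      - (1 - 2 * l * c1) * (norm (x - y))\<^sup>2 - (1 - 2 * l * c2) * (norm (y - z))\<^sup>2"
    using main by (simp add: algebra_simps)
qed

lemma relaxation_dist_le:
  fixes C :: "'a::real_inner set"
  assumes C: "convex C" and S: "nonexpansive_on C S" and z: "z \<in> C" and q: "q \<in> fix_set C S"
    and a: "0 < a" "a < 1"
  shows "(1 - a) *\<^sub>R z + a *\<^sub>R S z \<in> C"
    and "norm ((1 - a) *\<^sub>R z + a *\<^sub>R S z - q) \<le> norm (z - q)"
proof -
  have Sz: "S z \<in> C" using S z unfolding nonexpansive_on_def by blast
  show "(1 - a) *\<^sub>R z + a *\<^sub>R S z \<in> C" using C z Sz a by (auto intro: convexD)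
  have "norm (S z - S q) \<le> norm (z - q)" and "S q = q"
    using S z q unfolding nonexpansive_on_def fix_set_def by blast+
  then have Sq: "norm (S z - q) \<le> norm (z - q)" by simp
  have "(1 - a) *\<^sub>R z + a *\<^sub>R S z - q = (1 - a) *\<^sub>R (z - q) + a *\<^sub>R (S z - q)"
    by (simp add: algebra_simps)
  also have "norm \<dots> \<le> (1 - a) * norm (z - q) + a * norm (S z - q)"
    using norm_triangle_ineq[of "(1 - a) *\<^sub>R (z - q)" "a *\<^sub>R (S z - q)"] a by simp
  also have "\<dots> \<le> norm (z - q)"
    using Sq a by (intro convex_bound_le) auto
  finally show "norm ((1 - a) *\<^sub>R z + a *\<^sub>R S z - q) \<le> norm (z - q)" .
qed

text \<open>
  After the projection onto \<open>C\<close> is dropped, the square is expanded and the adjoint moved across. The mixed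
  term becomes an inner product in the second space, which the hypotheses on \<open>u\<close> and \<open>v\<close> bound by
  the negative of the two squared distances to \<open>A t\<close>, and \<open>norm_adjoint_le\<close> bounds the quadratic term.
\<close>
lemma split_step_dist_sq_le:
  fixes C :: "'a::{real_inner, banach} set" and A :: "'a \<Rightarrow> 'b::real_inner"
  assumes C: "C \<noteq> {}" "closed C" "convex C" and A: "bounded_linear A" and m: "0 < m"
    and q: "q \<in> C"
    and u: "(norm (u - A q))\<^sup>2 \<le> (norm (A t - A q))\<^sup>2 - (norm (u - A t))\<^sup>2"
    and v: "norm (v - A q) \<le> norm (u - A q)"
    and s: "s = metric_proj C (t + m *\<^sub>R adjoint A (v - A t))"
  shows "(norm (s - q))\<^sup>2 \<le> (norm (t - q))\<^sup>2 - m * (norm (u - A t))\<^sup>2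
    - m * (1 - m * (onorm A)\<^sup>2) * (norm (v - A t))\<^sup>2"
proof -
  interpret bounded_linear A by (rule A)
  define d where "d = v - A t"
  let ?p = "t + m *\<^sub>R adjoint A d"
  have "(norm (q - s))\<^sup>2 \<le> (norm (q - ?p))\<^sup>2"
    using metric_proj_dist_sq_le[OF C q, of ?p] unfolding s d_def by (smt (verit) zero_le_power2)
  then have "(norm (s - q))\<^sup>2 \<le> (norm (?p - q))\<^sup>2" by (simp only: norm_minus_commute)
  also have "\<dots> = (norm (t - q))\<^sup>2 + 2 * m * ((t - q) \<bullet> adjoint A d) + m\<^sup>2 * (norm (adjoint A d))\<^sup>2"
  proof -
    have "?p - q = (t - q) + m *\<^sub>R adjoint A d" by simp
    then show ?thesis
      by (simp only: power2_norm_eq_inner)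
        (simp add: inner_add_left inner_add_right inner_commute power2_eq_square)
  qed
  also have "(t - q) \<bullet> adjoint A d = (A t - A q) \<bullet> d"
    by (simp add: inner_adjoint[OF A] diff)
  also have "m\<^sup>2 * (norm (adjoint A d))\<^sup>2 \<le> m\<^sup>2 * ((onorm A)\<^sup>2 * (norm d)\<^sup>2)"
    using norm_adjoint_le[OF A, of d]
    by (intro mult_left_mono) (metis norm_ge_zero power_mono power_mult_distrib, simp)
  finally have 1: "(norm (s - q))\<^sup>2
      \<le> (norm (t - q))\<^sup>2 + m * (2 * ((A t - A q) \<bullet> d)) + m\<^sup>2 * ((onorm A)\<^sup>2 * (norm d)\<^sup>2)"
    by simp
  have "2 * ((A t - A q) \<bullet> d) = (norm (v - A q))\<^sup>2 - (norm (A t - A q))\<^sup>2 - (norm d)\<^sup>2"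
    unfolding d_def by (simp add: power2_norm_eq_inner algebra_simps inner_commute)
  moreover have "(norm (v - A q))\<^sup>2 \<le> (norm (u - A q))\<^sup>2" using v by (simp add: power_mono)
  ultimately have "2 * ((A t - A q) \<bullet> d) \<le> - (norm (u - A t))\<^sup>2 - (norm d)\<^sup>2" using u by linarith
  then have "m * (2 * ((A t - A q) \<bullet> d)) \<le> m * (- (norm (u - A t))\<^sup>2 - (norm d)\<^sup>2)"
    using m by simp
  with 1 show ?thesis unfolding d_def[symmetric] by (simp add: algebra_simps power2_eq_square)
qed

text \<open>
  The squares of \<open>r\<close> cancel, which leaves a half-space.
\<close>
lemma closed_convex_nearer:
  fixes s t :: "'a::real_inner"
  shows "closed {r. norm (s - r) \<le> norm (t - r)}" "convex {r. norm (s - r) \<le> norm (t - r)}"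
proof -
  show "closed {r. norm (s - r) \<le> norm (t - r)}"
    by (intro closed_Collect_le continuous_intros)
  have "norm (s - r) \<le> norm (t - r) \<longleftrightarrow> (s - t) \<bullet> r \<ge> (s \<bullet> s - t \<bullet> t) / 2" for r
    by (simp add: norm_le inner_diff_left inner_diff_right inner_commute) linarith
  then have "{r. norm (s - r) \<le> norm (t - r)} = {r. (s - t) \<bullet> r \<ge> (s \<bullet> s - t \<bullet> t) / 2}" by simp
  then show "convex {r. norm (s - r) \<le> norm (t - r)}" using convex_halfspace_ge by metis
qed

section \<open>Convergence of the iteration\<close>
lemma nonexpansive_on_tendsto:
  assumes "nonexpansive_on D S" "\<And>n. X n \<in> D" "l \<in> D" "X \<longlonglongrightarrow> l"
  shows "(\<lambda>n. S (X n)) \<longlonglongrightarrow> S l"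
proof (rule LIM_zero_cancel, rule Lim_null_comparison)
  show "\<forall>\<^sub>F n in sequentially. norm (S (X n) - S l) \<le> norm (X n - l)"
    using assms(1-3) unfolding nonexpansive_on_def by simp
  show "(\<lambda>n. norm (X n - l)) \<longlonglongrightarrow> 0" using assms(4) by (simp add: tendsto_norm_zero LIM_zero)
qed

lemma tendsto_imp_weakly_converges:
  assumes "X \<longlonglongrightarrow> l"
  shows "weakly_converges X l"
  unfolding weakly_converges_def using assms by (blast intro: bounded_linear.tendsto)

lemma tendsto_if_norm_diff_tendsto_0:
  fixes X Y :: "nat \<Rightarrow> 'a::real_normed_vector"
  assumes "(\<lambda>n. norm (X n - Y n)) \<longlonglongrightarrow> 0" "Y \<longlonglongrightarrow> l"
  shows "X \<longlonglongrightarrow> l"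
  by (rule Lim_transform[OF assms(2) tendsto_norm_zero_cancel[OF assms(1)]])

lemma tendsto_0_if_square_le:
  fixes d :: real and r e :: "nat \<Rightarrow> real"
  assumes "d > 0" "\<And>n. d * (r n)\<^sup>2 \<le> e n" "e \<longlonglongrightarrow> 0"
  shows "r \<longlonglongrightarrow> 0"
proof -
  have "(\<lambda>n. (r n)\<^sup>2) \<longlonglongrightarrow> 0"
  proof (rule tendsto_sandwich[OF _ _ tendsto_const])
    have "(\<lambda>n. e n / d) \<longlonglongrightarrow> 0 / d" using assms by (intro tendsto_intros) auto
    then show "(\<lambda>n. e n / d) \<longlonglongrightarrow> 0" by simp
    show "\<forall>\<^sub>F n in sequentially. (r n)\<^sup>2 \<le> e n / d"
      using assms(1,2) by (simp add: pos_le_divide_eq mult.commute)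
  qed simp
  then show ?thesis by simp
qed

text \<open>
  The lower bound on \<open>lam\<close> allows the inequality to be divided by \<open>lam n\<close>, so that its left side still
  tends to \<open>0\<close>.
\<close>
lemma prox_limit_in_sol_set:
  fixes C :: "'a::real_inner set"
  assumes C: "closed C" and B: "assumptions_B C f c1 c2"
    and X: "X \<longlonglongrightarrow> p" and Y: "Y \<longlonglongrightarrow> p" and XC: "\<And>n. X n \<in> C" and YC: "\<And>n. Y n \<in> C"
    and a: "a > 0" and lam: "\<And>n. a \<le> lam n"
    and prox: "\<And>n v. v \<in> C \<Longrightarrow> (X n - Y n) \<bullet> (v - Y n) \<le> lam n * (f (X n) v - f (X n) (Y n))"
  shows "p \<in> sol_set C f"
proof -
  have pC: "p \<in> C" by (rule closed_sequentially[OF C XC X])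
  have "0 \<le> f p v" if v: "v \<in> C" for v
  proof -
    have fc: "(\<lambda>n. f (X n) (R n)) \<longlonglongrightarrow> f p r" if "\<And>n. R n \<in> C" "r \<in> C" "R \<longlonglongrightarrow> r" for R r
      using B XC pC that tendsto_imp_weakly_converges[OF X] tendsto_imp_weakly_converges[OF that(3)]
      unfolding assumptions_B_def by blast
    have f0: "f p p = 0" using B pC unfolding assumptions_B_def by blast
    have pos: "lam n > 0" for n using lam[of n] a by linarith
    have le: "(X n - Y n) \<bullet> (v - Y n) / lam n \<le> f (X n) v - f (X n) (Y n)" for n
      using prox[OF v, of n] pos[of n] by (simp add: divide_le_eq mult.commute)
    have "(\<lambda>n. (X n - Y n) \<bullet> (v - Y n) / lam n) \<longlonglongrightarrow> 0"
    proof (rule Lim_null_comparison)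
      show "\<forall>\<^sub>F n in sequentially. norm ((X n - Y n) \<bullet> (v - Y n) / lam n)
          \<le> \<bar>(X n - Y n) \<bullet> (v - Y n)\<bar> / a"
      proof (rule always_eventually, rule allI)
        fix n
        have "\<bar>(X n - Y n) \<bullet> (v - Y n)\<bar> / lam n \<le> \<bar>(X n - Y n) \<bullet> (v - Y n)\<bar> / a"
          using lam a pos by (intro divide_left_mono) auto
        then show "norm ((X n - Y n) \<bullet> (v - Y n) / lam n) \<le> \<bar>(X n - Y n) \<bullet> (v - Y n)\<bar> / a"
          using pos[of n] by simp
      qed
      have "(\<lambda>n. \<bar>(X n - Y n) \<bullet> (v - Y n)\<bar> / a) \<longlonglongrightarrow> \<bar>(p - p) \<bullet> (v - p)\<bar> / a"
        using a by (intro tendsto_intros X Y) auto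
      then show "(\<lambda>n. \<bar>(X n - Y n) \<bullet> (v - Y n)\<bar> / a) \<longlonglongrightarrow> 0" by simp
    qed
    moreover have "(\<lambda>n. f (X n) v - f (X n) (Y n)) \<longlonglongrightarrow> f p v - f p p"
      by (intro tendsto_diff fc YC pC Y v tendsto_const)
    ultimately have "0 \<le> f p v - f p p" by (rule LIMSEQ_le) (use le in blast)
    then show ?thesis using f0 by simp
  qed
  with pC show ?thesis by (simp add: sol_set_def)
qed

text \<open>
  No continuity of \<open>g\<close> in its first argument is available along the sequence, so monotonicity first
  exchanges the arguments; lower semicontinuity in the second argument gives \<open>g v l \<le> 0\<close> in the
  limit, and \<open>minty\<close> exchanges the arguments back.
\<close>
lemma resolvent_limit_in_sol_set:
  fixes Q :: "'a::{real_inner, banach} set"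
  assumes A: "assumptions_A Q g" and Q: "Q \<noteq> {}" "closed Q" "convex Q"
    and d: "d > 0" "\<forall>\<^sub>F n in sequentially. d \<le> c n"
    and null: "(\<lambda>n. norm (resolvent Q g (c n) (w n) - w n)) \<longlonglongrightarrow> 0"
    and lim: "(\<lambda>n. resolvent Q g (c n) (w n)) \<longlonglongrightarrow> l"
  shows "l \<in> sol_set Q g"
proof -
  obtain N where N: "\<And>n. n \<ge> N \<Longrightarrow> d \<le> c n"
    using d(2) unfolding eventually_sequentially by blast
  define U where "U n = resolvent Q g (c (n + N)) (w (n + N))" for n
  define W where "W n = w (n + N)" for n
  define b where "b n = c (n + N)" for n
  have b: "d \<le> b n" "b n > 0" for n using N[of "n + N"] d(1) unfolding b_def by auto
  have U: "U \<longlonglongrightarrow> l" unfolding U_def by (rule LIMSEQ_ignore_initial_segment[OF lim])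
  have UW: "(\<lambda>n. norm (U n - W n)) \<longlonglongrightarrow> 0"
    unfolding U_def W_def by (rule LIMSEQ_ignore_initial_segment[OF null])
  have UQ: "U n \<in> Q" for n
    unfolding U_def by (rule resolvent_in[OF A Q b(2)[unfolded b_def]])
  have lQ: "l \<in> Q" by (rule closed_sequentially[OF Q(2) UQ U])
  have dual: "g v l \<le> 0" if v: "v \<in> Q" for v
  proof -
    have lsc: "lsc_on Q (g v)" using A v unfolding assumptions_A_def by blast
    define r where "r n = norm (v - U n) * norm (U n - W n) / d" for n
    have "r \<longlonglongrightarrow> norm (v - l) * 0 / d"
      unfolding r_def using d(1) by (intro tendsto_intros U UW) auto
    then have r: "r \<longlonglongrightarrow> 0" by simp
    have le: "g v (U n) \<le> r n" for n
    proof -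
      have "g v (U n) + g (U n) v \<le> 0" using A v UQ[of n] unfolding assumptions_A_def by blast
      moreover have "0 \<le> g (U n) v + 1 / b n * ((v - U n) \<bullet> (U n - W n))"
        unfolding U_def W_def b_def by (rule resolvent_ineq[OF A Q b(2)[unfolded b_def] v])
      ultimately have "g v (U n) \<le> (v - U n) \<bullet> (U n - W n) / b n" by simp
      also have "\<dots> \<le> norm (v - U n) * norm (U n - W n) / b n"
        using b(2)[of n] by (intro divide_right_mono norm_cauchy_schwarz) auto
      also have "\<dots> \<le> r n"
        unfolding r_def using b[of n] d(1) by (intro divide_left_mono) auto
      finally show ?thesis .
    qed
    show ?thesis by (rule lsc_on_tendsto_le[OF lsc lQ U UQ r le])
  qed
  have "0 \<le> g l v" if "v \<in> Q" for v
    using minty[OF A lQ _ that, of 0] dual by simp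
  with lQ show ?thesis by (simp add: sol_set_def)
qed

theorem theorem2:
  fixes C :: "'h1::{real_inner, banach} set"
    and Q :: "'h2::{real_inner, banach} set"
    and S :: "'h1 \<Rightarrow> 'h1" and T :: "'h2 \<Rightarrow> 'h2"
    and f :: "'h1 \<Rightarrow> 'h1 \<Rightarrow> real" and g :: "'h2 \<Rightarrow> 'h2 \<Rightarrow> real"
    and A :: "'h1 \<Rightarrow> 'h2"
    and c1 c2 a b \<alpha> \<mu> :: real
    and lam \<alpha>s :: "nat \<Rightarrow> real"
    and x y z t s :: "nat \<Rightarrow> 'h1" and u :: "nat \<Rightarrow> 'h2"
    and Cs :: "nat \<Rightarrow> 'h1 set"
    and \<Omega> :: "'h1 set"
  assumes "C \<noteq> {}" "closed C" "convex C"
    and "Q \<noteq> {}" "closed Q" "convex Q"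
    and "nonexpansive_on C S" "nonexpansive_on Q T"
    and "assumptions_A Q g"
    and "assumptions_B C f c1 c2"
    and "bounded_linear A"
    and "a \<in> {0<..<min (1 / (2 * c1)) (1 / (2 * c2))}"
    and "b \<in> {0<..<min (1 / (2 * c1)) (1 / (2 * c2))}"
    and "\<And>k. k \<ge> 1 \<Longrightarrow> lam k \<in> {a..b}"
    and "0 < \<alpha>" "\<alpha> < 1"
    \<comment> \<open>in the extended reals, so that the bound is \<open>\<infinity>\<close> if \<open>A\<close> is the zero operator\<close>
    and "0 < \<mu>" "ereal \<mu> < 1 / (ereal (onorm A))\<^sup>2"
    and "\<And>k. k \<ge> 1 \<Longrightarrow> \<alpha>s k > 0"
    and "liminf (\<lambda>k. ereal (\<alpha>s k)) > 0"
    and "x 1 \<in> C" "Cs 1 = C"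
    and "\<And>k. k \<ge> 1 \<Longrightarrow>
           y k = arg_min_on (\<lambda>v. lam k * f (x k) v + 1 / 2 * (norm (v - x k))\<^sup>2) C"
    and "\<And>k. k \<ge> 1 \<Longrightarrow>
           z k = arg_min_on (\<lambda>v. lam k * f (y k) v + 1 / 2 * (norm (v - x k))\<^sup>2) C"
    and "\<And>k. k \<ge> 1 \<Longrightarrow> t k = (1 - \<alpha>) *\<^sub>R z k + \<alpha> *\<^sub>R S (z k)"
    and "\<And>k. k \<ge> 1 \<Longrightarrow> u k = resolvent Q g (\<alpha>s k) (A (t k))"
    and "\<And>k. k \<ge> 1 \<Longrightarrow> s k = metric_proj C (t k + \<mu> *\<^sub>R adjoint A (T (u k) - A (t k)))"
    and "\<And>k. k \<ge> 1 \<Longrightarrow>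
           Cs (k + 1) = {r \<in> Cs k. norm (s k - r) \<le> norm (t k - r) \<and> norm (t k - r) \<le> norm (x k - r)}"
    and "\<And>k. k \<ge> 1 \<Longrightarrow> x (k + 1) = metric_proj (Cs (k + 1)) (x 1)"
    and "\<Omega> = {q \<in> sol_set C f \<inter> fix_set C S. A q \<in> sol_set Q g \<inter> fix_set Q T}"
    and "\<Omega> \<noteq> {}"
  shows "\<exists>p\<in>\<Omega>. x \<longlonglongrightarrow> p \<and> z \<longlonglongrightarrow> p \<and> u \<longlonglongrightarrow> A p \<and> A p \<in> sol_set Q g \<inter> fix_set Q T"
proof -
  note C = assms(1-3) and Q = assms(4-6)
  have S: "nonexpansive_on C S" and T: "nonexpansive_on Q T"
    and gA: "assumptions_A Q g" and fB: "assumptions_B C f c1 c2" and A: "bounded_linear A"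
    using assms(7-11) by auto
  note lam = assms(14) and \<alpha>s_pos = assms(19) and y_def = assms(23) and z_def = assms(24)
    and t_def = assms(25) and u_def = assms(26) and s_def = assms(27) and Cs_Suc = assms(28)
    and x_Suc = assms(29) and \<Omega>_def = assms(30)
  interpret A: bounded_linear A by (rule A)
  have c: "c1 > 0" "c2 > 0" using fB unfolding assumptions_B_def by blast+
  have a: "a > 0" and b: "2 * b * c1 < 1" "2 * b * c2 < 1"
    using assms(12,13) c by (auto simp: field_simps)
  have \<mu>: "0 < \<mu>" "\<mu> * (onorm A)\<^sup>2 < 1"
  proof -
    show "0 < \<mu>" by (rule assms(17))
    show "\<mu> * (onorm A)\<^sup>2 < 1"
    proof (cases "onorm A = 0")
      case False
      then have "(onorm A)\<^sup>2 > 0" by simp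
      moreover have "\<mu> < 1 / (onorm A)\<^sup>2"
        using assms(18) False by (simp add: power2_eq_square one_ereal_def)
      ultimately show ?thesis by (simp add: field_simps)
    qed simp
  qed
  obtain q where q\<Omega>: "q \<in> \<Omega>" using assms(31) by blast
  \<comment> \<open>The guard \<open>x k \<in> C\<close> is needed because membership of the iterates in \<open>C\<close> is established only by the
    later induction, which uses these bounds. The factors \<open>lam k\<close> are replaced by \<open>b\<close> to make
    the coefficients independent of \<open>k\<close>.\<close>
  have step:
    "y k \<in> C \<and> z k \<in> C \<and> t k \<in> C \<and> u k \<in> Q \<and> s k \<in> C"
    "r \<in> \<Omega> \<Longrightarrow> (norm (z k - r))\<^sup>2 \<le> (norm (x k - r))\<^sup>2
      - (1 - 2 * b * c1) * (norm (x k - y k))\<^sup>2 - (1 - 2 * b * c2) * (norm (y k - z k))\<^sup>2"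
    "r \<in> \<Omega> \<Longrightarrow> norm (t k - r) \<le> norm (z k - r)"
    "r \<in> \<Omega> \<Longrightarrow> (norm (s k - r))\<^sup>2 \<le> (norm (t k - r))\<^sup>2 - \<mu> * (norm (u k - A (t k)))\<^sup>2
      - \<mu> * (1 - \<mu> * (onorm A)\<^sup>2) * (norm (T (u k) - A (t k)))\<^sup>2"
    "v \<in> C \<Longrightarrow> (x k - y k) \<bullet> (v - y k) \<le> lam k * f (x k) v - lam k * f (x k) (y k)"
    if k: "k \<ge> 1" and xC: "x k \<in> C" for k r v
  proof -
    have l: "0 < lam k" "lam k \<le> b" using lam[OF k] a by auto
    have r: "r \<in> sol_set C f" "r \<in> fix_set C S" "A r \<in> sol_set Q g" "A r \<in> fix_set Q T" "r \<in> C"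
      if "r \<in> \<Omega>" for r
      using that unfolding \<Omega>_def sol_set_def by auto
    note ext = extragradient_dist_sq_le[OF C fB l(1) xC _ y_def[OF k] z_def[OF k]]
    note q' = r[OF q\<Omega>]
    have yz: "y k \<in> C" "z k \<in> C" using ext(1,2)[OF q'(1)] by auto
    have tC: "t k \<in> C"
      unfolding t_def[OF k] by (rule relaxation_dist_le[OF C(3) S yz(2) q'(2) assms(15,16)])
    have uQ: "u k \<in> Q" unfolding u_def[OF k] by (rule resolvent_in[OF gA Q \<alpha>s_pos[OF k]])
    have "s k \<in> C" unfolding s_def[OF k] by (rule metric_proj_in[OF C])
    with yz tC uQ show "y k \<in> C \<and> z k \<in> C \<and> t k \<in> C \<and> u k \<in> Q \<and> s k \<in> C" by blast
    show "v \<in> C \<Longrightarrow> (x k - y k) \<bullet> (v - y k) \<le> lam k * f (x k) v - lam k * f (x k) (y k)"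
      by (rule ext(3)[OF q'(1)])
    assume r\<Omega>: "r \<in> \<Omega>"
    note r = r[OF r\<Omega>]
    have "lam k * c1 \<le> b * c1" "lam k * c2 \<le> b * c2" using l c by (auto intro: mult_right_mono)
    then have "(1 - 2 * b * c1) * (norm (x k - y k))\<^sup>2 \<le> (1 - 2 * lam k * c1) * (norm (x k - y k))\<^sup>2"
      "(1 - 2 * b * c2) * (norm (y k - z k))\<^sup>2 \<le> (1 - 2 * lam k * c2) * (norm (y k - z k))\<^sup>2"
      by (auto intro!: mult_right_mono)
    then show "(norm (z k - r))\<^sup>2 \<le> (norm (x k - r))\<^sup>2
      - (1 - 2 * b * c1) * (norm (x k - y k))\<^sup>2 - (1 - 2 * b * c2) * (norm (y k - z k))\<^sup>2"
      using ext(4)[OF r(1)] by linarith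
    show "norm (t k - r) \<le> norm (z k - r)"
      unfolding t_def[OF k] by (rule relaxation_dist_le[OF C(3) S yz(2) r(2) assms(15,16)])
    have "norm (T (u k) - T (A r)) \<le> norm (u k - A r)" "T (A r) = A r"
      using T uQ r(4) unfolding nonexpansive_on_def fix_set_def by blast+
    then have Tu: "norm (T (u k) - A r) \<le> norm (u k - A r)" by simp
    have res: "(norm (u k - A r))\<^sup>2 \<le> (norm (A (t k) - A r))\<^sup>2 - (norm (u k - A (t k)))\<^sup>2"
      unfolding u_def[OF k] by (rule resolvent_dist_sq_le[OF gA Q \<alpha>s_pos[OF k] r(3)])
    show "(norm (s k - r))\<^sup>2 \<le> (norm (t k - r))\<^sup>2 - \<mu> * (norm (u k - A (t k)))\<^sup>2
      - \<mu> * (1 - \<mu> * (onorm A)\<^sup>2) * (norm (T (u k) - A (t k)))\<^sup>2"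
      by (rule split_step_dist_sq_le[OF C A \<mu>(1) r(5) res Tu s_def[OF k]])
  qed
  have tx: "norm (t k - r) \<le> norm (x k - r)" and st: "norm (s k - r) \<le> norm (t k - r)"
    if k: "k \<ge> 1" "x k \<in> C" and r: "r \<in> \<Omega>" for k r
  proof -
    have "0 \<le> (1 - 2 * b * c1) * (norm (x k - y k))\<^sup>2" "0 \<le> (1 - 2 * b * c2) * (norm (y k - z k))\<^sup>2"
      using b by auto
    then have "(norm (z k - r))\<^sup>2 \<le> (norm (x k - r))\<^sup>2" using step(2)[OF k r] by linarith
    then show "norm (t k - r) \<le> norm (x k - r)"
      using step(3)[OF k r] by (simp add: abs_le_square_iff[symmetric])
    have "0 \<le> \<mu> * (norm (u k - A (t k)))\<^sup>2"
      "0 \<le> \<mu> * (1 - \<mu> * (onorm A)\<^sup>2) * (norm (T (u k) - A (t k)))\<^sup>2"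
      using \<mu> by auto
    then have "(norm (s k - r))\<^sup>2 \<le> (norm (t k - r))\<^sup>2" using step(4)[OF k r] by linarith
    then show "norm (s k - r) \<le> norm (t k - r)" by (simp add: abs_le_square_iff[symmetric])
  qed
  \<comment> \<open>The first iterate is also the projection of \<open>x 1\<close> onto its set, since \<open>Cs 1 = C\<close> contains it.\<close>
  have inv: "\<Omega> \<subseteq> Cs (Suc n) \<and> Cs (Suc n) \<subseteq> C \<and> closed (Cs (Suc n)) \<and> convex (Cs (Suc n))
      \<and> x (Suc n) = metric_proj (Cs (Suc n)) (x 1) \<and> x (Suc n) \<in> Cs (Suc n)" for n
  proof (induction n)
    case 0
    have "x 1 = metric_proj C (x 1)"
      using metric_proj_inner_le[OF C assms(21), of "x 1"]
      by (metis inner_eq_zero_iff inner_ge_zero order_antisym right_minus_eq)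
    moreover have "\<Omega> \<subseteq> C" unfolding \<Omega>_def sol_set_def by auto
    ultimately show ?case using C assms(21,22) by simp
  next
    case (Suc n)
    let ?k = "Suc n"
    have k: "?k \<ge> 1" and xC: "x ?k \<in> C" using Suc.IH by auto
    have eq: "Cs (Suc ?k) = Cs ?k \<inter> {r. norm (s ?k - r) \<le> norm (t ?k - r)}
        \<inter> {r. norm (t ?k - r) \<le> norm (x ?k - r)}"
      using Cs_Suc[OF k] by auto
    have sub: "\<Omega> \<subseteq> Cs (Suc ?k)" using Suc.IH tx[OF k xC] st[OF k xC] unfolding eq by blast
    have cc: "closed (Cs (Suc ?k))" "convex (Cs (Suc ?k))"
      using Suc.IH closed_convex_nearer unfolding eq by (auto intro!: closed_Int convex_Int)
    have ne: "Cs (Suc ?k) \<noteq> {}" using sub q\<Omega> by blast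
    have xeq: "x (Suc ?k) = metric_proj (Cs (Suc ?k)) (x 1)" using x_Suc[OF k] by simp
    have "x (Suc ?k) \<in> Cs (Suc ?k)" unfolding xeq by (rule metric_proj_in[OF ne cc])
    moreover have "Cs (Suc ?k) \<subseteq> C" using Suc.IH unfolding eq by blast
    ultimately show ?case using sub cc xeq by blast
  qed
  \<comment> \<open>The iteration starts at index \<open>1\<close> and says nothing about index \<open>0\<close>; shifted sequences have
    their properties at every index.\<close>
  define X where "X n = x (Suc n)" for n
  define Y where "Y n = y (Suc n)" for n
  define Z where "Z n = z (Suc n)" for n
  define W where "W n = t (Suc n)" for n
  define U where "U n = u (Suc n)" for n
  define V where "V n = s (Suc n)" for n
  note shift = X_def Y_def Z_def W_def U_def V_def
  have XC: "X n \<in> C" for n using inv[of n] by (auto simp: X_def)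
  have one: "Suc n \<ge> 1" for n by simp
  note step' = step[OF one XC[unfolded X_def], folded shift]
  have XS: "X (Suc n) \<in> Cs (Suc (Suc n))" for n using inv[of "Suc n"] unfolding X_def by blast
  have near: "norm (V n - X (Suc n)) \<le> norm (W n - X (Suc n))"
    "norm (W n - X (Suc n)) \<le> norm (X n - X (Suc n))" for n
    using XS[of n] Cs_Suc[OF one, of n] by (auto simp: shift)
  have "Cs (Suc (Suc n)) \<subseteq> Cs (Suc n)" for n using Cs_Suc[OF one, of n] by auto
  then have dec: "Cs (Suc m) \<subseteq> Cs (Suc n)" if "n \<le> m" for m n
    using lift_Suc_antimono_le[of "\<lambda>n. Cs (Suc n)"] that by blast
  have "convergent (\<lambda>n. metric_proj (Cs (Suc n)) (x 1))"
    by (rule metric_proj_decreasing_convergent[where q = q]) (use inv dec q\<Omega> in blast)+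
  moreover have "metric_proj (Cs (Suc n)) (x 1) = X n" for n
    using inv[of n] unfolding X_def by metis
  ultimately obtain p where p: "X \<longlonglongrightarrow> p" unfolding convergent_def by auto
  have pC: "p \<in> C" by (rule closed_sequentially[OF C(2) XC p])
  have "(\<lambda>n. norm (X n - X (Suc n))) \<longlonglongrightarrow> norm (p - p)"
    by (intro tendsto_intros p LIMSEQ_Suc[OF p])
  then have dX: "(\<lambda>n. norm (X n - X (Suc n))) \<longlonglongrightarrow> 0" by simp
  have W: "W \<longlonglongrightarrow> p"
    by (rule tendsto_if_norm_diff_tendsto_0[OF _ LIMSEQ_Suc[OF p]])
      (rule tendsto_sandwich[OF _ _ tendsto_const dX]; use near in simp)
  have V: "V \<longlonglongrightarrow> p"
    by (rule tendsto_if_norm_diff_tendsto_0[OF _ LIMSEQ_Suc[OF p]])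
      (rule tendsto_sandwich[OF _ _ tendsto_const dX]; use order_trans[OF near] in simp)
  have gap: "(\<lambda>n. (norm (P n - q))\<^sup>2 - (norm (R n - q))\<^sup>2) \<longlonglongrightarrow> 0"
    if "P \<longlonglongrightarrow> p" "R \<longlonglongrightarrow> p" for P R
  proof -
    have "(\<lambda>n. (norm (P n - q))\<^sup>2 - (norm (R n - q))\<^sup>2) \<longlonglongrightarrow> (norm (p - q))\<^sup>2 - (norm (p - q))\<^sup>2"
      by (intro tendsto_intros that)
    then show ?thesis by simp
  qed
  have ext: "(1 - 2 * b * c1) * (norm (X n - Y n))\<^sup>2 + (1 - 2 * b * c2) * (norm (Y n - Z n))\<^sup>2
      \<le> (norm (X n - q))\<^sup>2 - (norm (W n - q))\<^sup>2" for n
  proof -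
    have "(norm (W n - q))\<^sup>2 \<le> (norm (Z n - q))\<^sup>2"
      using step'(3)[OF q\<Omega>, of n] by (simp add: power_mono)
    then show ?thesis using step'(2)[OF q\<Omega>, of n] by linarith
  qed
  have nonneg: "0 \<le> (1 - 2 * b * c1) * (norm (X n - Y n))\<^sup>2" "0 \<le> (1 - 2 * b * c2) * (norm (Y n - Z n))\<^sup>2" for n
    using b by auto
  have "(\<lambda>n. norm (X n - Y n)) \<longlonglongrightarrow> 0"
    by (rule tendsto_0_if_square_le[OF _ _ gap[OF p W], of "1 - 2 * b * c1"])
      (use b ext nonneg in \<open>smt (verit)\<close>)+
  then have Y: "Y \<longlonglongrightarrow> p"
    by (intro tendsto_if_norm_diff_tendsto_0[OF _ p]) (simp add: norm_minus_commute)
  have "(\<lambda>n. norm (Y n - Z n)) \<longlonglongrightarrow> 0"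
    by (rule tendsto_0_if_square_le[OF _ _ gap[OF p W], of "1 - 2 * b * c2"])
      (use b ext nonneg in \<open>smt (verit)\<close>)+
  then have Z: "Z \<longlonglongrightarrow> p"
    by (intro tendsto_if_norm_diff_tendsto_0[OF _ Y]) (simp add: norm_minus_commute)
  have split: "\<mu> * (norm (U n - A (W n)))\<^sup>2
      + (\<mu> * (1 - \<mu> * (onorm A)\<^sup>2)) * (norm (T (U n) - A (W n)))\<^sup>2
      \<le> (norm (W n - q))\<^sup>2 - (norm (V n - q))\<^sup>2" for n
    using step'(4)[OF q\<Omega>, of n] by linarith
  have \<mu>': "0 < \<mu> * (1 - \<mu> * (onorm A)\<^sup>2)" using \<mu> by simp
  have nonneg': "0 \<le> \<mu> * (norm (U n - A (W n)))\<^sup>2"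
    "0 \<le> (\<mu> * (1 - \<mu> * (onorm A)\<^sup>2)) * (norm (T (U n) - A (W n)))\<^sup>2" for n
    using \<mu>(1) \<mu>' by (auto simp del: mult_pos_pos)
  have AW: "(\<lambda>n. A (W n)) \<longlonglongrightarrow> A p" by (rule A.tendsto[OF W])
  have UW: "(\<lambda>n. norm (U n - A (W n))) \<longlonglongrightarrow> 0"
    by (rule tendsto_0_if_square_le[OF \<mu>(1) _ gap[OF W V]]) (use split nonneg' in \<open>smt (verit)\<close>)
  have U: "U \<longlonglongrightarrow> A p" by (rule tendsto_if_norm_diff_tendsto_0[OF UW AW])
  have "(\<lambda>n. norm (T (U n) - A (W n))) \<longlonglongrightarrow> 0"
    by (rule tendsto_0_if_square_le[OF \<mu>' _ gap[OF W V]]) (use split nonneg' in \<open>smt (verit)\<close>)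
  then have TU: "(\<lambda>n. T (U n)) \<longlonglongrightarrow> A p" by (rule tendsto_if_norm_diff_tendsto_0[OF _ AW])
  have UQ: "U n \<in> Q" for n using step'(1)[of n] by blast
  have ApQ: "A p \<in> Q" by (rule closed_sequentially[OF Q(2) UQ U])

  \<comment> \<open>As \<open>\<alpha>\<close> is positive, \<open>S z\<close> can be recovered from \<open>t\<close> and \<open>z\<close>, which have the same limit.\<close>
  have fixS: "S p = p"
  proof -
    have ZC: "Z n \<in> C" for n using step'(1)[of n] by blast
    have "(\<lambda>n. (1 / \<alpha>) *\<^sub>R (W n - (1 - \<alpha>) *\<^sub>R Z n)) \<longlonglongrightarrow> (1 / \<alpha>) *\<^sub>R (p - (1 - \<alpha>) *\<^sub>R p)"
      by (intro tendsto_intros W Z)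
    moreover have "(1 / \<alpha>) *\<^sub>R (W n - (1 - \<alpha>) *\<^sub>R Z n) = S (Z n)" for n
      using t_def[OF one, of n] assms(15) by (simp add: shift)
    moreover have "(1 / \<alpha>) *\<^sub>R (p - (1 - \<alpha>) *\<^sub>R p) = p"
      using assms(15) by (simp add: algebra_simps)
    ultimately have "(\<lambda>n. S (Z n)) \<longlonglongrightarrow> p" by simp
    moreover have "(\<lambda>n. S (Z n)) \<longlonglongrightarrow> S p" by (rule nonexpansive_on_tendsto[OF S ZC pC Z])
    ultimately show ?thesis by (rule LIMSEQ_unique[rotated])
  qed
  have fixT: "T (A p) = A p"
    using nonexpansive_on_tendsto[OF T UQ ApQ U] TU by (rule LIMSEQ_unique)

  have solf: "p \<in> sol_set C f"
  proof (rule prox_limit_in_sol_set[OF C(2) fB p Y XC])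
    show "Y n \<in> C" for n using step'(1)[of n] by blast
    show "a \<le> lam (Suc n)" for n using lam[OF one] by simp
    show "(X n - Y n) \<bullet> (v - Y n) \<le> lam (Suc n) * (f (X n) v - f (X n) (Y n))" if "v \<in> C" for n v
      using step'(5)[OF that, of n] by (simp add: right_diff_distrib)
  qed (rule a)

  obtain d where d: "0 < d" "ereal d < liminf (\<lambda>k. ereal (\<alpha>s k))"
    using ereal_dense2[OF assms(20)] by (auto simp: zero_ereal_def)
  have "\<forall>\<^sub>F k in sequentially. d < \<alpha>s k" using less_LiminfD[OF d(2)] by simp
  then have "\<forall>\<^sub>F n in sequentially. d \<le> \<alpha>s (Suc n)"
    by (subst eventually_sequentially_Suc) (auto elim: eventually_mono)
  then have solg: "A p \<in> sol_set Q g"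
    using resolvent_limit_in_sol_set[OF gA Q d(1), of "\<lambda>n. \<alpha>s (Suc n)" "\<lambda>n. A (W n)"] UW U
    unfolding shift u_def[OF one] by blast

  have "p \<in> \<Omega>"
    unfolding \<Omega>_def fix_set_def using pC ApQ fixS fixT solf solg by simp
  moreover have "x \<longlonglongrightarrow> p" "z \<longlonglongrightarrow> p" "u \<longlonglongrightarrow> A p"
    using p Z U unfolding X_def Z_def U_def by (auto dest: LIMSEQ_imp_Suc)
  moreover have "A p \<in> sol_set Q g \<inter> fix_set Q T" using ApQ fixT solg by (simp add: fix_set_def)
  ultimately show ?thesis by blast
qed

end
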